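(* Let $f\in\mathcal{M}$ be pretentious. Then $\|f\|_{u^1}=0$ if and only if $M(f)=0$.
   Context: $\mathcal{M}$ is the class of multiplicative functions $f:\mathbb{N}\to\mathbb{C}$ ($f(mn)=f(m)f(n)$ for coprime $m,n$) with $|f|\le1$. $f\in\mathcal{M}$ is pretentious if there are a Dirichlet character $\chi$ and $t\in\mathbb{R}$ with $\sum_{p\text{ prime}}\frac1p\big(1-\mathrm{Re}(f(p)\overline{\chi(p)p^{it}})\big)<+\infty$. $M(f)=0$ means that the mean $\lim_{N\to\infty}\frac1N\sum_{n\le N}f(n)$ exists and equals $0$. Let $\mathbb{U}$ be the closed unit disc, $S$ the left shift on $\mathbb{U}^{\mathbb{Z}}$, and view $f$ as an element of $\mathbb{U}^{\mathbb{Z}}$ (extended e.g. by $0$ to non-positive integers). An increasing sequence $(N_k)$ defines a Furstenberg system of $f$ if $\frac1{N_k}\sum_{n\le N_k}\delta_{S^nf}$ converges in the weak$^*$ topology as $k\to\infty$. For such $(N_k)$, $$\|f\|^2_{u^1((N_k))}=\lim_{H\to\infty}\frac1H\sum_{h\le H}\Big(\lim_{k\to\infty}\frac1{N_k}\sum_{n\le N_k}f(n)\overline{f(n+h)}\Big).$$ The statement $\|f\|_{u^1}=0$ means that $\|f\|_{u^1((N_k))}=0$ for every $(N_k)$ defining a Furstenberg system of $f$. *)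

theory Defs
  imports "HOL-Probability.Probability"
begin

text \<open>
  Functions on the positive integers are represented by functions on \<^typ>\<open>nat\<close>;
  their value at \<open>0\<close> is never used.
\<close>

definition mult_unit_disc :: "(nat \<Rightarrow> complex) set" where
  "mult_unit_disc =
     {f. (\<forall>m>0. \<forall>n>0. coprime m n \<longrightarrow> f (m * n) = f m * f n) \<and> (\<forall>n>0. norm (f n) \<le> 1)}"

text \<open>The last clause excludes the zero function and forces \<open>\<psi> 1 = 1\<close>.\<close>

definition dirichlet_character :: "nat \<Rightarrow> (nat \<Rightarrow> complex) \<Rightarrow> bool" where
  "dirichlet_character q \<psi> \<longleftrightarrow>
     q > 0 \<and> (\<forall>m n. \<psi> (m * n) = \<psi> m * \<psi> n) \<and> (\<forall>n. \<psi> (n + q) = \<psi> n) \<and>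
     (\<forall>n. \<psi> n = 0 \<longleftrightarrow> \<not> coprime n q)"

text \<open>
  For \<open>\<bar>f\<bar> \<le> 1\<close> the terms of the series are nonnegative, so that (unconditional)
  summability over the primes is finiteness of the sum.
\<close>

definition pretentious :: "(nat \<Rightarrow> complex) \<Rightarrow> bool" where
  "pretentious f \<longleftrightarrow>
     (\<exists>q \<psi> (t::real). dirichlet_character q \<psi> \<and>
        (\<lambda>p. 1 / real p * (1 - Re (f p * cnj (\<psi> p * of_nat p powr (\<i> * of_real t)))))
          summable_on {p. prime p})"

definition mean_zero :: "(nat \<Rightarrow> complex) \<Rightarrow> bool" where
  "mean_zero f \<longleftrightarrow> (\<lambda>N. (\<Sum>n=1..N. f n) / of_nat N) \<longlonglongrightarrow> 0"


subsection \<open>Furstenberg systems\<close>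

text \<open>
  The type \<^typ>\<open>int \<Rightarrow> complex\<close> carries the product topology, so \<open>disc_seqs\<close> is the compact
  space of two-sided sequences in the closed unit disc and \<open>disc_seqs_borel\<close> is its Borel
  sigma-algebra.
\<close>

definition disc_seqs :: "(int \<Rightarrow> complex) set" where
  "disc_seqs = {x. \<forall>m. x m \<in> cball 0 1}"

abbreviation disc_seqs_borel :: "(int \<Rightarrow> complex) measure" where
  "disc_seqs_borel \<equiv> restrict_space borel disc_seqs"

definition shift :: "(int \<Rightarrow> complex) \<Rightarrow> (int \<Rightarrow> complex)" where
  "shift x = (\<lambda>m. x (m + 1))"

definition extend_by_zero :: "(nat \<Rightarrow> complex) \<Rightarrow> (int \<Rightarrow> complex)" where
  "extend_by_zero f = (\<lambda>m. if m > 0 then f (nat m) else 0)"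

text \<open>
  The average \<open>1/N \<Sum>\<^sub>n\<^sub>\<le>\<^sub>N \<delta>(S\<^sup>n f)\<close> of point masses, as the image of the uniform
  probability measure on \<open>{1..N}\<close>.
\<close>

definition empirical_measure :: "(nat \<Rightarrow> complex) \<Rightarrow> nat \<Rightarrow> (int \<Rightarrow> complex) measure" where
  "empirical_measure f N =
     distr (uniform_count_measure {1..N}) disc_seqs_borel
       (\<lambda>n. (shift ^^ n) (extend_by_zero f))"

definition weak_star_conv ::
    "(nat \<Rightarrow> (int \<Rightarrow> complex) measure) \<Rightarrow> (int \<Rightarrow> complex) measure \<Rightarrow> bool" where
  "weak_star_conv M \<mu> \<longleftrightarrow>
     (\<forall>\<phi> :: (int \<Rightarrow> complex) \<Rightarrow> complex. continuous_on disc_seqs \<phi> \<longrightarrow>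
        (\<lambda>k. \<integral>x. \<phi> x \<partial>M k) \<longlonglongrightarrow> (\<integral>x. \<phi> x \<partial>\<mu>))"

definition defines_furstenberg_system :: "(nat \<Rightarrow> complex) \<Rightarrow> (nat \<Rightarrow> nat) \<Rightarrow> bool" where
  "defines_furstenberg_system f N \<longleftrightarrow>
     strict_mono N \<and> N 0 > 0 \<and>
     (\<exists>\<mu>. prob_space \<mu> \<and> sets \<mu> = sets disc_seqs_borel \<and>
        weak_star_conv (\<lambda>k. empirical_measure f (N k)) \<mu>)"


subsection \<open>The seminorm\<close>

text \<open>
  The inner limit exists whenever \<open>N\<close> defines a Furstenberg system of \<open>f\<close>.
\<close>

definition correlation :: "(nat \<Rightarrow> complex) \<Rightarrow> (nat \<Rightarrow> nat) \<Rightarrow> nat \<Rightarrow> complex" where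
  "correlation f N h =
     lim (\<lambda>k. (\<Sum>n=1..N k. f n * cnj (f (n + h))) / of_nat (N k))"

text \<open>
  \<open>has_u1_seminorm f N s\<close> says that \<open>s\<close> is the seminorm of \<open>f\<close> along \<open>N\<close>, i.e. that the
  limit over \<open>H\<close> defining the squared seminorm exists and equals \<open>s\<^sup>2\<close>.
\<close>

definition has_u1_seminorm :: "(nat \<Rightarrow> complex) \<Rightarrow> (nat \<Rightarrow> nat) \<Rightarrow> real \<Rightarrow> bool" where
  "has_u1_seminorm f N s \<longleftrightarrow>
     s \<ge> 0 \<and> (\<lambda>H. (\<Sum>h=1..H. correlation f N h) / of_nat H) \<longlonglongrightarrow> of_real (s\<^sup>2)"

definition u1_seminorm_zero :: "(nat \<Rightarrow> complex) \<Rightarrow> bool" where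
  "u1_seminorm_zero f \<longleftrightarrow>
     (\<forall>N. defines_furstenberg_system f N \<longrightarrow> has_u1_seminorm f N 0)"

end

theory Submission
  imports Defs "HOL-Number_Theory.Number_Theory" "HOL-Real_Asymp.Real_Asymp"
begin

text \<open>
  Suppose \<open>f\<close> pretends to be \<open>\<chi>(n) n\<^bsup>it\<^esup>\<close>.  Split \<open>n = d n'\<close>, where \<open>d\<close> collects the primes up to a
  large \<open>P\<close>.  By the Turan-Kubilius inequality, \<open>f(n') / (\<chi>(n') n'\<^bsup>it\<^esup>)\<close> is close in mean over \<open>n \<le> N\<close>
  to a constant \<open>c\<close> that depends on \<open>N\<close> but is bounded away from \<open>0\<close>.  Outside a set of small
  density, \<open>d\<close> and \<open>\<chi>(n')\<close> depend only on a residue class of \<open>n\<close>.  Hence \<open>f(n)\<close> is close in mean to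
  \<open>c n\<^bsup>it\<^esup> G(n)\<close> with \<open>G\<close> periodic.  As \<open>n\<^bsup>it\<^esup>\<close> varies slowly, both the mean of \<open>f\<close> and its means over
  short intervals are governed by the mean of \<open>G\<close>; so if the former vanishes, then so do the
  latter and with them the averaged correlations.  Conversely, if \<open>f\<close> does not have mean zero,
  then along some sequence the means stay away from \<open>0\<close>; by compactness a subsequence defines a
  Furstenberg system, and van der Corput's inequality bounds the seminorm along it from below.
\<close>

subsection \<open>Concentration of multiplicative functions\<close>

text \<open>The constant \<open>c\<close> has to depend on \<open>N\<close>. Pretentiousness
  controls only the sum of (1 - Re h(p))/p, where h(p) is f(p) times the conjugate of \<chi>(p)
  p^(it); the imaginary parts Im h(p)/p need not be summable, so the argument of \<open>c\<close>
  may drift as \<open>N\<close> grows. All comparisons are therefore made inside one range 1..N with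
  a single \<open>c\<close>. The mean of n^(it) is never evaluated: a window of length N/K just
  beyond N freezes n^(it) up to |t|/K, and the sum of f over it is a difference of two initial sums.
  The approximation error of the whole range may fall on this short window, so it is magnified by K
  + 1. This forces the order of choices: t, K, \<epsilon>, the pair G and q, and finally the length
  H of the short averages. The mean of G is only shown to be small in terms of \<epsilon> and
  K.\<close>

lemma card_multiples:
  fixes N d :: nat
  shows "card {n\<in>{1..N}. d dvd n} = N div d"
proof (cases "d = 0")
  case True
  have e: "{n\<in>{1..N}. d dvd n} = {}" using True by auto
  show ?thesis unfolding e using True by simp
next
  case False
  have "bij_betw (\<lambda>k. d * k) {1..N div d} {n\<in>{1..N}. d dvd n}"
  proof (rule bij_betwI')
    show "\<And>x y. (d * x = d * y) = (x = y)" using False by auto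
    fix x assume x: "x \<in> {1..N div d}"
    have "d * x \<le> d * (N div d)" using x by simp
    also have "\<dots> \<le> N" by simp
    finally show "d * x \<in> {n\<in>{1..N}. d dvd n}" using x False by (auto simp: Suc_le_eq)
  next
    fix y assume y: "y \<in> {n\<in>{1..N}. d dvd n}"
    then obtain x where x: "y = d * x" by (auto elim: dvdE)
    have "x = y div d" using x False by simp
    then have "x \<le> N div d" using y by (simp add: div_le_mono)
    moreover have "x \<ge> 1" using x y by (cases x) auto
    ultimately show "\<exists>x\<in>{1..N div d}. y = d * x" using x by auto
  qed
  then show ?thesis by (simp add: bij_betw_same_card[symmetric])
qed

lemma sum_dvd_indicator:
  fixes N d :: nat
  shows "(\<Sum>n=1..N. of_bool (d dvd n)) = real (N div d)"
proof -
  have "(\<Sum>n=1..N. of_bool (d dvd n)) = real (card ({1..N} \<inter> {n. d dvd n}))"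
    by (simp add: sum_of_bool_eq)
  also have "{1..N} \<inter> {n. d dvd n} = {n\<in>{1..N}. d dvd n}" by auto
  finally show ?thesis by (simp only: card_multiples)
qed

lemma real_div_bounds:
  fixes N d :: nat
  assumes "d > 0"
  shows "real N / d - 1 \<le> real (N div d)" "real (N div d) \<le> real N / d"
  using assms floor_divide_of_nat_eq[of N d, where 'a = real] real_of_int_floor_ge_diff_one[of "real N / d"]
    of_int_floor_le[of "real N / d"] by auto

lemma sum_filter_of_bool:
  fixes f :: "'a \<Rightarrow> 'b::semiring_1"
  assumes "finite S"
  shows "(\<Sum>x\<in>{x\<in>S. P x}. f x) = (\<Sum>x\<in>S. f x * of_bool (P x))"
  unfolding sum.inter_filter[OF assms] by (intro sum.cong) auto

text \<open>Divisibility by distinct primes p and q is independent up to rounding: the densities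
  1/(p q), 1/p and 1/q cancel and only the errors of integer division remain. For p = q the sum is a
  variance, at most N/p.\<close>

lemma divisor_indicator_correlation:
  fixes N p q :: nat
  assumes p: "prime p" and q: "prime q"
  defines "K \<equiv> (\<Sum>n=1..N. (of_bool (p dvd n) - 1/real p) * (of_bool (q dvd n) - 1/real q))"
  shows "\<bar>K\<bar> \<le> (if p = q then N / p else 0) + 1"
proof -
  have p2: "real p \<ge> 2" and q2: "real q \<ge> 2"
    using prime_ge_2_nat[OF p] prime_ge_2_nat[OF q] by simp_all
  show ?thesis
  proof (cases "p = q")
    case True
    have "K = (\<Sum>n=1..N. of_bool (p dvd n) * (1 - 2/real p) + 1 / real p ^ 2)"
      unfolding K_def True[symmetric]
      by (intro sum.cong refl) (auto simp: algebra_simps power2_eq_square of_bool_def diff_divide_distrib)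
    also have "\<dots> = real (N div p) * (1 - 2/p) + N / real p ^ 2"
      unfolding sum.distrib sum_distrib_right[symmetric] sum_dvd_indicator by simp
    finally have K: "K = real (N div p) * (1 - 2/p) + N / real p ^ 2" .
    have "\<bar>K\<bar> = real (N div p) * (1 - 2/p) + N / real p ^ 2" unfolding K using p2 by (intro abs_of_nonneg add_nonneg_nonneg mult_nonneg_nonneg) auto
    also have "\<dots> \<le> (N / p) * (1 - 2/p) + N / real p ^ 2"
      using real_div_bounds(2)[of p N] p2 by (intro add_mono mult_right_mono) auto
    also have "\<dots> = N / p - N / real p ^ 2" using p2 by (simp add: field_simps power2_eq_square)
    also have "\<dots> \<le> N / p" by simp
    finally show ?thesis using True by simp
  next
    case False
    then have cop: "coprime p q" using p q primes_coprime by blast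
    have eq: "(p * q dvd n) \<longleftrightarrow> p dvd n \<and> q dvd n" for n
      using cop by (metis divides_mult dvd_mult_left dvd_mult_right)
    have "K = (\<Sum>n=1..N. of_bool (p * q dvd n) - of_bool (p dvd n) / q - of_bool (q dvd n) / p + 1 / (real p * q))"
      unfolding K_def
      by (intro sum.cong refl) (auto simp: algebra_simps of_bool_def eq)
    also have "\<dots> = real (N div (p*q)) - real (N div p) / q - real (N div q) / p + N / (real p * q)"
      unfolding sum.distrib sum_subtractf sum_divide_distrib[symmetric] sum_dvd_indicator by simp
    finally have K: "K = real (N div (p*q)) - real (N div p) / q - real (N div q) / p + N / (real p * q)" .
    \<comment> \<open>These are the rounding errors of the three integer divisions. Each lies in
      [0, 1], and p, q \<ge> 2 keeps b/q + c/p within [0, 1], so the difference with a stays within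
      [-1, 1].\<close>
    define a b c where "a = N / (real p * q) - real (N div (p*q))" and "b = real N / p - real (N div p)"
      and "c = real N / q - real (N div q)"
    have K2: "K = b / q + c / p - a" unfolding K a_def b_def c_def using p2 q2 by (simp add: field_simps)
    have "0 \<le> a" "a \<le> 1" "0 \<le> b" "b \<le> 1" "0 \<le> c" "c \<le> 1"
      using real_div_bounds[of "p*q" N] real_div_bounds[of p N] real_div_bounds[of q N] p2 q2
      unfolding a_def b_def c_def by simp_all
    moreover from this have "0 \<le> b/q" "b/q \<le> 1/2" "0 \<le> c/p" "c/p \<le> 1/2"
      using p2 q2 by (auto simp: field_simps)
    ultimately have "\<bar>K\<bar> \<le> 1" unfolding K2 by linarith
    then show ?thesis using False by simp
  qed
qed

text \<open>Expanding the square pairs the coefficients with the covariances \<open>K p q\<close>.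
  The diagonal gives N times the sum on the right. The remaining bound 1 per pair leaves the square
  of a sum; Cauchy-Schwarz with weights sqrt p turns it into the same sum times the total of all p
  in S, which p * p \<le> N keeps below N.\<close>

lemma Turan_Kubilius_small:
  fixes a :: "nat \<Rightarrow> complex" and N :: nat
  assumes fin: "finite S" and S: "\<And>p. p \<in> S \<Longrightarrow> prime p \<and> p * p \<le> N"
  shows "(\<Sum>n=1..N. (norm ((\<Sum>p\<in>{p\<in>S. p dvd n}. a p) - (\<Sum>p\<in>S. a p / of_nat p)))\<^sup>2)
         \<le> 2 * N * (\<Sum>p\<in>S. (norm (a p))\<^sup>2 / p)"
proof -
  define X :: "nat \<Rightarrow> nat \<Rightarrow> real" where "X p n = of_bool (p dvd n) - 1 / real p" for p n
  define K where "K p q = (\<Sum>n=1..N. X p n * X q n)" for p q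
  define A where "A = (\<Sum>p\<in>S. (norm (a p))\<^sup>2 / p)"
  have 1: "(\<Sum>p\<in>{p\<in>S. p dvd n}. a p) - (\<Sum>p\<in>S. a p / of_nat p) = (\<Sum>p\<in>S. a p * of_real (X p n))" for n
  proof -
    have "(\<Sum>p\<in>{p\<in>S. p dvd n}. a p) = (\<Sum>p\<in>S. if p dvd n then a p else 0)"
      using fin by (rule sum.inter_filter)
    then show ?thesis
      by (simp add: sum_subtractf[symmetric] X_def) (intro sum.cong refl, auto simp: algebra_simps)
  qed
  have 2: "of_real ((norm (\<Sum>p\<in>S. a p * of_real (X p n)))\<^sup>2) 
      = (\<Sum>p\<in>S. \<Sum>q\<in>S. a p * cnj (a q) * of_real (X p n * X q n))" for n
    unfolding complex_norm_square
    by (simp add: sum_product algebra_simps)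
  have "complex_of_real (\<Sum>n=1..N. (norm (\<Sum>p\<in>S. a p * of_real (X p n)))\<^sup>2) 
      = (\<Sum>n=1..N. \<Sum>p\<in>S. \<Sum>q\<in>S. a p * cnj (a q) * of_real (X p n * X q n))"
    by (simp only: of_real_sum 2)
  also have "\<dots> = (\<Sum>p\<in>S. \<Sum>n=1..N. \<Sum>q\<in>S. a p * cnj (a q) * of_real (X p n * X q n))" by (rule sum.swap)
  also have "\<dots> = (\<Sum>p\<in>S. \<Sum>q\<in>S. \<Sum>n=1..N. a p * cnj (a q) * of_real (X p n * X q n))"
    by (rule sum.cong[OF refl]) (rule sum.swap)
  also have "\<dots> = (\<Sum>p\<in>S. \<Sum>q\<in>S. a p * cnj (a q) * of_real (K p q))"
    by (simp only: K_def of_real_sum sum_distrib_left)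
  finally have 3: "complex_of_real (\<Sum>n=1..N. (norm (\<Sum>p\<in>S. a p * of_real (X p n)))\<^sup>2) = \<dots>" .
  have "(\<Sum>n=1..N. (norm (\<Sum>p\<in>S. a p * of_real (X p n)))\<^sup>2) = norm (complex_of_real (\<Sum>n=1..N. (norm (\<Sum>p\<in>S. a p * of_real (X p n)))\<^sup>2))"
    unfolding norm_of_real by (intro abs_of_nonneg[symmetric] sum_nonneg) auto
  also have "\<dots> \<le> (\<Sum>p\<in>S. \<Sum>q\<in>S. norm (a p) * norm (a q) * \<bar>K p q\<bar>)"
    unfolding 3 by (intro order.trans[OF norm_sum] sum_mono) (simp add: norm_mult)
  also have "\<dots> \<le> (\<Sum>p\<in>S. \<Sum>q\<in>S. norm (a p) * norm (a q) * ((if p = q then N / p else 0) + 1))"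
    unfolding K_def X_def using S
    by (intro sum_mono mult_left_mono divisor_indicator_correlation) auto
  also have "\<dots> = (\<Sum>p\<in>S. \<Sum>q\<in>S. (if p = q then (norm (a p))\<^sup>2 * (N / p) else 0)) + (\<Sum>p\<in>S. \<Sum>q\<in>S. norm (a p) * norm (a q))"
    unfolding sum.distrib[symmetric] by (intro sum.cong refl) (auto simp: algebra_simps power2_eq_square)
  also have "\<dots> = N * A + (\<Sum>p\<in>S. norm (a p))\<^sup>2"
    using fin by (simp add: A_def sum_distrib_left power2_eq_square sum_product mult_ac)
  also have "(\<Sum>p\<in>S. norm (a p))\<^sup>2 \<le> N * A"
  proof -
    have "(\<Sum>p\<in>S. norm (a p)) = (\<Sum>p\<in>S. (norm (a p) / sqrt p) * sqrt p)"
      using S by (intro sum.cong refl) (auto dest!: prime_gt_0_nat)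
    then have "(\<Sum>p\<in>S. norm (a p))\<^sup>2 \<le> (\<Sum>p\<in>S. (norm (a p) / sqrt p)\<^sup>2) * (\<Sum>p\<in>S. (sqrt p)\<^sup>2)"
      using Cauchy_Schwarz_ineq_sum[of "\<lambda>p. norm (a p) / sqrt p" "\<lambda>p. sqrt p" S] by simp
    also have "(\<Sum>p\<in>S. (norm (a p) / sqrt p)\<^sup>2) = A"
      unfolding A_def by (intro sum.cong refl) (simp add: power_divide)
    also have "(\<Sum>p\<in>S. (sqrt p)\<^sup>2) = real (\<Sum>p\<in>S. p)" by simp
    also have "A * real (\<Sum>p\<in>S. p) \<le> A * N"
    proof (rule mult_left_mono)
      have "(\<Sum>p\<in>S. p) \<le> N"
      proof (cases "S = {}")
        case False
        define y where "y = Max S"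
        have yS: "y \<in> S" using False fin by (simp add: y_def)
        have sub: "S \<subseteq> {1..y}" using fin S prime_ge_1_nat by (auto simp: y_def)
        have "(\<Sum>p\<in>S. p) \<le> card S * y" using sub by (intro order.trans[OF sum_bounded_above[of S "\<lambda>p. p" y]]) auto
        also have "card S \<le> y" using card_mono[OF _ sub] by simp
        then have "card S * y \<le> y * y" by simp
        also have "\<dots> \<le> N" using S yS by auto
        finally show ?thesis .
      qed auto
      then show "real (\<Sum>p\<in>S. p) \<le> real N" by linarith
      show "A \<ge> 0" unfolding A_def by (intro sum_nonneg) auto
    qed
    finally show ?thesis by (simp add: mult.commute)
  qed
  finally show ?thesis unfolding 1 A_def by (simp add: algebra_simps)
qed

lemma sum_large_prime_divisors:
  fixes a :: "nat \<Rightarrow> complex" and N :: nat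
  assumes fin: "finite T" and T: "\<And>p. p \<in> T \<Longrightarrow> prime p \<and> p * p > N"
  shows "(\<Sum>n=1..N. (norm (\<Sum>p\<in>{p\<in>T. p dvd n}. a p))\<^sup>2) \<le> N * (\<Sum>p\<in>T. (norm (a p))\<^sup>2 / p)"
proof -
  have 1: "(norm (\<Sum>p\<in>{p\<in>T. p dvd n}. a p))\<^sup>2 = (\<Sum>p\<in>T. (norm (a p))\<^sup>2 * of_bool (p dvd n))"
    if n: "n \<in> {1..N}" for n
  proof -
    have uniq: "p = q" if pq: "p \<in> T" "q \<in> T" "p dvd n" "q dvd n" for p q
    proof (rule ccontr)
      assume "p \<noteq> q"
      then have "p * q dvd n" using pq T primes_coprime[of p q] by (simp add: divides_mult)
      then have le: "p * q \<le> N" using n by (auto dest: dvd_imp_le)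
      have "(p * q) * (p * q) = (p * p) * (q * q)" by simp
      also have "\<dots> > N * N" using T pq by (intro mult_strict_mono') auto
      finally have "N * N < (p * q) * (p * q)" .
      then show False using mult_le_mono[OF le le] by linarith
    qed
    have "(\<Sum>p\<in>T. (norm (a p))\<^sup>2 * of_bool (p dvd n)) = (\<Sum>p\<in>{p\<in>T. p dvd n}. (norm (a p))\<^sup>2)"
      by (rule sum_filter_of_bool[OF fin, symmetric])
    also have "\<dots> = (norm (\<Sum>p\<in>{p\<in>T. p dvd n}. a p))\<^sup>2"
    proof (cases "{p\<in>T. p dvd n} = {}")
      case False
      then obtain p where "p \<in> T" "p dvd n" by auto
      then have "{p\<in>T. p dvd n} = {p}" using uniq by blast
      then show ?thesis by simp
    next
      case True
      show ?thesis unfolding True by simp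
    qed
    finally show ?thesis by simp
  qed
  have "(\<Sum>n=1..N. (norm (\<Sum>p\<in>{p\<in>T. p dvd n}. a p))\<^sup>2) = (\<Sum>n=1..N. \<Sum>p\<in>T. (norm (a p))\<^sup>2 * of_bool (p dvd n))"
    by (intro sum.cong refl 1)
  also have "\<dots> = (\<Sum>p\<in>T. \<Sum>n=1..N. (norm (a p))\<^sup>2 * of_bool (p dvd n))" by (rule sum.swap)
  also have "\<dots> = (\<Sum>p\<in>T. (norm (a p))\<^sup>2 * real (N div p))"
    by (simp only: sum_distrib_left[symmetric] sum_dvd_indicator)
  also have "\<dots> \<le> (\<Sum>p\<in>T. (norm (a p))\<^sup>2 * (real N / p))"
    using T by (intro sum_mono mult_left_mono real_div_bounds) (auto simp: prime_gt_0_nat)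
  finally show ?thesis by (simp add: sum_distrib_left mult_ac)
qed

text \<open>On the convex half-plane Re z \<le> 0 the derivative of exp has norm at most 1. The
  estimate serves twice: for exponentials of sums of h(p) - 1 and, on the imaginary axis, for
  increments of n^(it).\<close>

lemma norm_exp_diff_le:
  fixes z w :: complex
  assumes "Re z \<le> 0" "Re w \<le> 0"
  shows "norm (exp z - exp w) \<le> norm (z - w)"
proof -
  have "norm (exp z - exp w) \<le> 1 * norm (z - w)"
  proof (rule field_differentiable_bound[of "{z. Re z \<le> 0}"])
    show "convex {z. Re z \<le> 0}" by (rule convex_halfspace_Re_le)
    show "(exp has_field_derivative exp z) (at z within {z. Re z \<le> 0})" for z :: complex
      by (rule has_field_derivative_at_within[OF DERIV_exp])
  qed (use assms in auto)
  then show ?thesis by simp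
qed

text \<open>Replacing a factor z by exp (z - 1) costs only second order, and turns a product over
  primes into the exponential of an additive function. The 9 bounds e^2, since |Re (z - 1)| \<le>
  2.\<close>

lemma norm_minus_exp_le:
  fixes z :: complex
  assumes "norm z \<le> 1"
  shows "norm (z - exp (z - 1)) \<le> 9 * (norm (z - 1))\<^sup>2"
proof -
  define w where "w = z - 1"
  have "\<bar>Re w\<bar> \<le> 2" using abs_Re_le_cmod[of z] assms by (auto simp: w_def)
  then have "exp \<bar>Re w\<bar> \<le> exp (1 + 1 :: real)" by simp
  also have "\<dots> = exp 1 * (exp 1::real)" by (rule exp_add)
  also have "\<dots> \<le> 3 * 3" using exp_le by (intro mult_mono) auto
  finally have e: "exp \<bar>Re w\<bar> \<le> 9" by simp
  have "norm (z - exp (z - 1)) = norm (exp w - (\<Sum>k\<le>1. w ^ k / fact k))"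
    by (simp add: w_def norm_minus_commute)
  also have "\<dots> \<le> exp \<bar>Re w\<bar> * (norm w) ^ 2"
    using Taylor_exp[of w 1] by (simp add: numeral_2_eq_2)
  also have "\<dots> \<le> 9 * (norm w)\<^sup>2" using e by (intro mult_right_mono) auto
  finally show ?thesis by (simp add: w_def)
qed

text \<open>The centre \<open>c\<close> only collects the primes up to \<open>sqrt N\<close>: the Turan-Kubilius error terms are
  negligible there without any estimate on the number of primes, and an \<open>n \<le> N\<close> has at most one
  larger prime factor.\<close>

lemma multiplicative_concentration:
  fixes h :: "nat \<Rightarrow> complex" and N :: nat and \<eta> :: real
  assumes fin: "finite S" and S: "\<And>p. p \<in> S \<Longrightarrow> prime p" and h: "\<And>p. p \<in> S \<Longrightarrow> norm (h p) \<le> 1"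
    and small: "(\<Sum>p\<in>S. (1 - Re (h p)) / p) \<le> \<eta>"
  obtains c where "norm c \<le> 1" "norm c \<ge> 1 - \<eta>"
    "(\<Sum>n=1..N. norm ((\<Prod>p\<in>{p\<in>S. p dvd n}. h p) - c)) \<le> N * (18 * \<eta> + sqrt (12 * \<eta>))"
proof -
  define a where "a p = h p - 1" for p
  define S1 where "S1 = {p\<in>S. p * p \<le> N}"
  define S2 where "S2 = {p\<in>S. p * p > N}"
  define A where "A = (\<Sum>p\<in>S. (norm (a p))\<^sup>2 / p)"
  define \<mu> where "\<mu> = (\<Sum>p\<in>S1. a p / of_nat p)"
  define g where "g n = (\<Sum>p\<in>{p\<in>S. p dvd n}. a p)" for n
  have fin12: "finite S1" "finite S2" using fin by (auto simp: S1_def S2_def)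
  have Re_h: "Re (h p) \<le> 1" if "p \<in> S" for p using complex_Re_le_cmod[of "h p"] h[OF that] by linarith
  \<comment> \<open>On the unit disc |z - 1|^2 \<le> 2 (1 - Re z): the first-order hypothesis thus
    controls the second moment \<open>A\<close>.\<close>
  have a2: "(norm (a p))\<^sup>2 \<le> 2 * (1 - Re (h p))" if "p \<in> S" for p
  proof -
    have "(norm (a p))\<^sup>2 = (norm (h p))\<^sup>2 + 1 - 2 * Re (h p)"
      unfolding cmod_power2 a_def by (simp add: power2_eq_square algebra_simps)
    moreover have "(norm (h p))\<^sup>2 \<le> 1" using h[OF that] by (simp add: power_le_one)
    ultimately show ?thesis by simp
  qed
  have A: "A \<le> 2 * \<eta>"
  proof -
    have "A \<le> (\<Sum>p\<in>S. 2 * ((1 - Re (h p)) / p))"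
      unfolding A_def using a2 by (intro sum_mono) (auto simp: divide_right_mono)
    also have "\<dots> = 2 * (\<Sum>p\<in>S. (1 - Re (h p)) / p)" by (rule sum_distrib_left[symmetric])
    finally show ?thesis using small by linarith
  qed
  have A0: "A \<ge> 0" unfolding A_def by (intro sum_nonneg) auto
  have "- \<eta> \<le> (\<Sum>p\<in>S. Re (a p) / p)"
  proof -
    have "(\<Sum>p\<in>S. Re (a p) / p) = - (\<Sum>p\<in>S. (1 - Re (h p)) / p)"
      unfolding sum_negf[symmetric] by (intro sum.cong refl) (simp add: a_def minus_divide_left)
    then show ?thesis using small by linarith
  qed
  \<comment> \<open>Every term is \<le> 0, so dropping the large primes from the centre can only
    raise its real part.\<close>
  also have "\<dots> \<le> (\<Sum>p\<in>S1. Re (a p) / p)"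
    using fin Re_h by (intro sum_mono2[of S S1 "\<lambda>p. - (Re (a p) / p)", unfolded sum_negf, simplified])
      (auto simp: S1_def a_def divide_nonpos_nonneg)
  also have "\<dots> = Re \<mu>" by (simp add: \<mu>_def Re_divide_of_nat)
  finally have mu1: "Re \<mu> \<ge> - \<eta>" .
  have mu2: "Re \<mu> \<le> 0" unfolding \<mu>_def Re_sum
    using Re_h by (intro sum_nonpos) (auto simp: S1_def a_def Re_divide_of_nat divide_nonpos_nonneg)
  have g: "Re (g n) \<le> 0" for n unfolding g_def Re_sum
    using Re_h by (intro sum_nonpos) (auto simp: a_def)
  have step1: "norm ((\<Prod>p\<in>{p\<in>S. p dvd n}. h p) - exp (g n)) \<le> (\<Sum>p\<in>S. 9 * (norm (a p))\<^sup>2 * of_bool (p dvd n))" for n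
  proof -
    have "exp (g n) = (\<Prod>p\<in>{p\<in>S. p dvd n}. exp (a p))" using fin by (simp add: g_def exp_sum)
    then have "norm ((\<Prod>p\<in>{p\<in>S. p dvd n}. h p) - exp (g n)) \<le> (\<Sum>p\<in>{p\<in>S. p dvd n}. norm (h p - exp (a p)))"
      using h Re_h by (simp only:) (intro norm_prod_diff, auto simp: a_def)
    also have "\<dots> \<le> (\<Sum>p\<in>{p\<in>S. p dvd n}. 9 * (norm (a p))\<^sup>2)"
      unfolding a_def using h by (intro sum_mono norm_minus_exp_le) auto
    also have "\<dots> = (\<Sum>p\<in>S. 9 * (norm (a p))\<^sup>2 * of_bool (p dvd n))"
      by (rule sum_filter_of_bool[OF fin])
    finally show ?thesis .
  qed
  have sum1: "(\<Sum>n=1..N. norm ((\<Prod>p\<in>{p\<in>S. p dvd n}. h p) - exp (g n))) \<le> N * (9 * A)"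
  proof -
    have "(\<Sum>n=1..N. norm ((\<Prod>p\<in>{p\<in>S. p dvd n}. h p) - exp (g n))) 
        \<le> (\<Sum>n=1..N. \<Sum>p\<in>S. 9 * (norm (a p))\<^sup>2 * of_bool (p dvd n))"
      by (intro sum_mono step1)
    also have "\<dots> = (\<Sum>p\<in>S. \<Sum>n=1..N. 9 * (norm (a p))\<^sup>2 * of_bool (p dvd n))" by (rule sum.swap)
    also have "\<dots> = (\<Sum>p\<in>S. 9 * (norm (a p))\<^sup>2 * real (N div p))"
      by (simp only: sum_distrib_left[symmetric] sum_dvd_indicator)
    also have "\<dots> \<le> (\<Sum>p\<in>S. 9 * (norm (a p))\<^sup>2 * (real N / p))"
      using S by (intro sum_mono mult_left_mono real_div_bounds) (auto simp: prime_gt_0_nat)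
    finally show ?thesis by (simp add: A_def sum_distrib_left mult_ac)
  qed
  have sum2: "(\<Sum>n=1..N. (norm (g n - \<mu>))\<^sup>2) \<le> N * (6 * A)"
  proof -
    define g1 where "g1 n = (\<Sum>p\<in>{p\<in>S1. p dvd n}. a p) - \<mu>" for n
    define g2 where "g2 n = (\<Sum>p\<in>{p\<in>S2. p dvd n}. a p)" for n
    define A1 where "A1 = (\<Sum>p\<in>S1. (norm (a p))\<^sup>2 / p)"
    define A2 where "A2 = (\<Sum>p\<in>S2. (norm (a p))\<^sup>2 / p)"
    have A12: "A = A1 + A2" unfolding A_def A1_def A2_def using fin
      by (subst sum.union_disjoint[symmetric]) (auto simp: S1_def S2_def intro!: sum.cong)
    have "A1 \<ge> 0" "A2 \<ge> 0" unfolding A1_def A2_def by (auto intro!: sum_nonneg)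
    have gg: "g n - \<mu> = g1 n + g2 n" for n
    proof -
      have "g n = (\<Sum>p\<in>{p\<in>S1. p dvd n} \<union> {p\<in>S2. p dvd n}. a p)"
        unfolding g_def by (intro sum.cong) (auto simp: S1_def S2_def)
      also have "\<dots> = (\<Sum>p\<in>{p\<in>S1. p dvd n}. a p) + (\<Sum>p\<in>{p\<in>S2. p dvd n}. a p)"
        using fin by (intro sum.union_disjoint) (auto simp: S1_def S2_def)
      finally show ?thesis by (simp add: g1_def g2_def)
    qed
    have "(norm (g n - \<mu>))\<^sup>2 \<le> 2 * (norm (g1 n))\<^sup>2 + 2 * (norm (g2 n))\<^sup>2" for n
    proof -
      have "(norm (g1 n + g2 n))\<^sup>2 \<le> (norm (g1 n) + norm (g2 n))\<^sup>2"
        by (intro power_mono norm_triangle_ineq) auto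
      also have "\<dots> \<le> 2 * (norm (g1 n))\<^sup>2 + 2 * (norm (g2 n))\<^sup>2"
        using sum_squares_bound[of "norm (g1 n)" "norm (g2 n)"] by (simp add: power2_sum)
      finally show ?thesis by (simp add: gg)
    qed
    then have "(\<Sum>n=1..N. (norm (g n - \<mu>))\<^sup>2) \<le> (\<Sum>n=1..N. 2 * (norm (g1 n))\<^sup>2 + 2 * (norm (g2 n))\<^sup>2)"
      by (intro sum_mono)
    also have "\<dots> = 2 * (\<Sum>n=1..N. (norm (g1 n))\<^sup>2) + 2 * (\<Sum>n=1..N. (norm (g2 n))\<^sup>2)"
      by (simp add: sum.distrib sum_distrib_left)
    also have "\<dots> \<le> 2 * (2 * N * A1) + 2 * (N * A2)"
      unfolding g1_def g2_def \<mu>_def A1_def A2_def using fin12 S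
      by (intro add_mono mult_left_mono Turan_Kubilius_small sum_large_prime_divisors) (auto simp: S1_def S2_def)
    also have "\<dots> = N * (4 * A1 + 2 * A2)" by (simp add: algebra_simps)
    also have "\<dots> \<le> N * (6 * A)" using \<open>A1 \<ge> 0\<close> \<open>A2 \<ge> 0\<close> by (intro mult_left_mono) (auto simp: A12)
    finally show ?thesis .
  qed
  have sum3: "(\<Sum>n=1..N. norm (g n - \<mu>)) \<le> N * sqrt (6 * A)"
  proof (rule power2_le_imp_le)
    have "(\<Sum>n=1..N. norm (g n - \<mu>))\<^sup>2 \<le> (\<Sum>n=1..N. (norm (g n - \<mu>))\<^sup>2) * (\<Sum>n=1..N. 1\<^sup>2)"
      using Cauchy_Schwarz_ineq_sum[of "\<lambda>n. norm (g n - \<mu>)" "\<lambda>n. 1" "{1..N}"] by simp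
    also have "\<dots> \<le> (N * (6 * A)) * (\<Sum>n=1..N. 1\<^sup>2)" by (intro mult_right_mono sum2) auto
    also have "\<dots> = (N * sqrt (6 * A))\<^sup>2" using A0 by (simp add: power_mult_distrib power2_eq_square)
    finally show "(\<Sum>n=1..N. norm (g n - \<mu>))\<^sup>2 \<le> (N * sqrt (6 * A))\<^sup>2" .
    show "0 \<le> N * sqrt (6 * A)" using A0 by simp
  qed
  have "(\<Sum>n=1..N. norm ((\<Prod>p\<in>{p\<in>S. p dvd n}. h p) - exp \<mu>))
      \<le> (\<Sum>n=1..N. norm ((\<Prod>p\<in>{p\<in>S. p dvd n}. h p) - exp (g n)) + norm (g n - \<mu>))"
  proof (rule sum_mono)
    fix n
    have "norm ((\<Prod>p\<in>{p\<in>S. p dvd n}. h p) - exp \<mu>) \<le> norm ((\<Prod>p\<in>{p\<in>S. p dvd n}. h p) - exp (g n)) + norm (exp (g n) - exp \<mu>)"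
      using norm_triangle_ineq[of "(\<Prod>p\<in>{p\<in>S. p dvd n}. h p) - exp (g n)" "exp (g n) - exp \<mu>"] by simp
    then show "norm ((\<Prod>p\<in>{p\<in>S. p dvd n}. h p) - exp \<mu>) \<le> norm ((\<Prod>p\<in>{p\<in>S. p dvd n}. h p) - exp (g n)) + norm (g n - \<mu>)"
      using norm_exp_diff_le[OF g mu2, of n] by linarith
  qed
  \<comment> \<open>The 9 A comes from replacing factors by exponentials, sqrt (6 A) from the
    variance by Cauchy-Schwarz; A \<le> 2 \<eta> yields the constants 18 and 12.\<close>
  also have "\<dots> \<le> N * (9 * A) + N * sqrt (6 * A)" unfolding sum.distrib by (intro add_mono sum1 sum3)
  also have "\<dots> \<le> N * (9 * (2 * \<eta>)) + N * sqrt (6 * (2 * \<eta>))"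
    using A by (intro add_mono mult_left_mono real_sqrt_le_mono) auto
  finally have "(\<Sum>n=1..N. norm ((\<Prod>p\<in>{p\<in>S. p dvd n}. h p) - exp \<mu>)) \<le> N * (18 * \<eta> + sqrt (12 * \<eta>))"
    by (simp add: algebra_simps)
  \<comment> \<open>The centre is c = exp \<mu>, whose modulus depends on Re \<mu> alone; Im \<mu>
    is not controlled.\<close>
  moreover have "norm (exp \<mu>) \<le> 1" using mu2 by simp
  moreover have "norm (exp \<mu>) \<ge> 1 - \<eta>" using mu1 exp_ge_add_one_self[of "Re \<mu>"] unfolding norm_exp_eq_Re by linarith
  ultimately show thesis using that by blast
qed


subsection \<open>Approximation of pretentious functions\<close>

text \<open>The function \<open>n \<mapsto> n\<^bsup>it\<^esup>\<close>; here \<open>ln 0 = 0\<close> makes it unimodular at \<open>0\<close> too.\<close>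

definition nit :: "real \<Rightarrow> nat \<Rightarrow> complex" where
  "nit t n = exp (\<i> * of_real (t * ln (real n)))"

lemma powr_eq_nit: "n > 0 \<Longrightarrow> of_nat n powr (\<i> * of_real t) = nit t n"
  unfolding nit_def powr_def using Ln_of_nat[of n] by (simp add: mult_ac)

lemma norm_nit [simp]: "norm (nit t n) = 1"
  unfolding nit_def by (rule norm_exp_i_times)

lemma nit_mult: "m > 0 \<Longrightarrow> n > 0 \<Longrightarrow> nit t (m * n) = nit t m * nit t n"
  by (simp add: nit_def ln_mult algebra_simps exp_add)

lemma nit_prod:
  assumes "finite S" "\<And>p. p \<in> S \<Longrightarrow> p > 0"
  shows "nit t (\<Prod>S) = (\<Prod>p\<in>S. nit t p)"
  using assms
proof (induction S)
  case empty
  show ?case by (simp add: nit_def)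
next
  case (insert p S)
  then have "\<Prod>S > 0" by (intro prod_pos) auto
  then show ?case using insert by (simp add: nit_mult)
qed

section \<open>Dirichlet characters and periodic functions\<close>

lemma dirichlet_character_one:
  assumes "dirichlet_character q \<psi>"
  shows "\<psi> 1 = 1"
proof -
  have "\<psi> 1 = \<psi> 1 * \<psi> 1" using assms unfolding dirichlet_character_def by (metis mult_1)
  moreover have "\<psi> 1 \<noteq> 0" using assms unfolding dirichlet_character_def by simp
  ultimately show ?thesis by simp
qed

lemma periodic_add_mult:
  fixes G :: "nat \<Rightarrow> 'a"
  assumes "\<And>n. G (n + q) = G n"
  shows "G (n + k * q) = G n"
proof (induction k)
  case (Suc k)
  have "G (n + Suc k * q) = G ((n + k * q) + q)" by (simp add: algebra_simps)
  then show ?case using Suc assms by simp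
qed auto

lemma periodic_mod:
  fixes G :: "nat \<Rightarrow> 'a"
  assumes "\<And>n. G (n + q) = G n"
  shows "G (n mod q) = G n"
  using periodic_add_mult[of G q "n mod q" "n div q"] assms by simp

text \<open>By Euler's theorem the value at an n coprime to q has \<open>totient q\<close>-th power
  1, hence is a root of unity; the other values are 0.\<close>

lemma dirichlet_character_norm:
  assumes chi: "dirichlet_character q \<psi>"
  shows "coprime n q \<Longrightarrow> norm (\<psi> n) = 1" and "norm (\<psi> n) \<le> 1"
proof -
  have q: "q > 0" and mult: "\<And>m n. \<psi> (m * n) = \<psi> m * \<psi> n" and per: "\<And>n. \<psi> (n + q) = \<psi> n"
    and zero: "\<And>n. \<psi> n = 0 \<longleftrightarrow> \<not> coprime n q"
    using chi unfolding dirichlet_character_def by auto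
  have pow: "\<psi> (n ^ k) = \<psi> n ^ k" for k
    by (induction k) (use dirichlet_character_one[OF chi] mult in auto)
  show *: "norm (\<psi> n) = 1" if "coprime n q"
  proof -
    have "n ^ totient q mod q = 1 mod q" using euler_theorem[OF that] by (simp add: cong_def)
    then have "\<psi> (n ^ totient q) = \<psi> 1" using periodic_mod[of \<psi>, OF per] by metis
    then have "\<psi> n ^ totient q = 1" using pow dirichlet_character_one[OF chi] by simp
    then show ?thesis using power_eq_1_iff[of "\<psi> n" "totient q"] q by auto
  qed
  show "norm (\<psi> n) \<le> 1" using * zero[of n] by (cases "coprime n q") auto
qed

lemma dirichlet_character_prod:
  assumes "dirichlet_character q \<psi>"
  shows "\<psi> (\<Prod>S) = (\<Prod>p\<in>S. \<psi> p)"
proof (induction S rule: infinite_finite_induct)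
  case (insert x F)
  then show ?case using assms by (simp add: dirichlet_character_def)
qed (use dirichlet_character_one[OF assms] in auto)

lemma multiplicative_prod_primes:
  fixes f :: "nat \<Rightarrow> 'a::comm_monoid_mult"
  assumes f: "\<And>m n. m > 0 \<Longrightarrow> n > 0 \<Longrightarrow> coprime m n \<Longrightarrow> f (m * n) = f m * f n" and f1: "f 1 = 1"
    and S: "finite S" "\<And>p. p \<in> S \<Longrightarrow> prime p"
  shows "f (\<Prod>S) = (\<Prod>p\<in>S. f p)"
  using S
proof (induction S)
  case (insert p S)
  have "\<Prod>S > 0" using insert by (intro prod_pos) (auto intro: prime_gt_0_nat)
  moreover have "coprime p (\<Prod>S)" using insert by (intro prod_coprime_right) (auto intro: primes_coprime)
  ultimately show ?case using insert by (simp add: f prime_gt_0_nat)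
qed (use f1 in auto)

section \<open>Separating small and large prime factors\<close>

text \<open>The integers on which the splitting behaves well. Exponents of small primes below P let
  a gcd with one fixed number capture the whole small part; the exponent 2 for large primes makes
  the rest squarefree, so that multiplicativity alone expresses f there through its values at
  primes.\<close>

definition almost_squarefree :: "nat \<Rightarrow> nat \<Rightarrow> bool" where
  "almost_squarefree P n \<longleftrightarrow> (\<forall>p. prime p \<longrightarrow> \<not> p ^ (if p \<le> P then P else 2) dvd n)"

text \<open>In \<open>fact P ^ P\<close> each prime p \<le> P occurs to a power at least P, above
  its exponent in n, and no other prime occurs. Hence the gcd is the full P-smooth part of n, and it
  depends only on n modulo a fixed number.\<close>

lemma rough_part:
  fixes n P :: nat
  assumes n: "n > 0" and good: "almost_squarefree P n"
  defines "d \<equiv> gcd n (fact P ^ P)"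
  shows "coprime d (n div d)" and "n div d = \<Prod>{p. prime p \<and> P < p \<and> p dvd n}"
proof -
  have pow_dvd: "p ^ k dvd m \<longleftrightarrow> k \<le> multiplicity p m" if "prime p" "m > 0" for p k m :: nat
    using that by (intro power_dvd_iff_le_multiplicity) (auto simp: prime_nat_iff)
  have d0: "d > 0" and dn: "d dvd n" using n by (auto simp: d_def)
  define n' where "n' = n div d"
  have nn': "n = d * n'" using dn by (simp add: n'_def)
  have n'0: "n' > 0" using n nn' by (cases n') auto
  have rough: "p > P" if p: "prime p" "p dvd n'" for p
  proof (rule ccontr)
    assume "\<not> p > P"
    then have pP: "p \<le> P" by simp
    define e where "e = multiplicity p n"
    have "\<not> p ^ P dvd n" using good pP p by (auto simp: almost_squarefree_def split: if_splits)
    then have "e < P" by (simp add: pow_dvd p n e_def)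
    then have "p ^ e dvd p ^ P" by (intro le_imp_power_dvd) simp
    also have "p ^ P dvd fact P ^ P" using pP p by (intro dvd_power_same dvd_fact prime_ge_1_nat) auto
    finally have "p ^ e dvd d" by (auto simp: d_def e_def multiplicity_dvd)
    then have "p ^ e * p dvd n" using p by (auto simp: nn' intro: mult_dvd_mono)
    then have "Suc e \<le> multiplicity p n" using pow_dvd[OF p(1) n, of "Suc e"] by (simp add: mult.commute)
    then show False by (simp add: e_def)
  qed
  have small: "p \<le> P" if p: "prime p" "p dvd d" for p
  proof -
    have "p dvd fact P ^ P" using p by (auto simp: d_def)
    then have "p dvd fact P" using p by (auto dest: prime_dvd_power)
    then show ?thesis using p by (simp add: prime_dvd_fact_iff)
  qed
  have "coprime d n'"
  proof (rule ccontr)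
    assume "\<not> coprime d n'"
    then have "gcd d n' \<noteq> 1" by (simp only: coprime_iff_gcd_eq_1 not_False_eq_True)
    then obtain p where "prime p" "p dvd gcd d n'" using prime_factor_nat[of "gcd d n'"] by blast
    then show False using rough[of p] small[of p] by auto
  qed
  then show "coprime d (n div d)" by (simp only: n'_def)
  have "n' = (\<Prod>p\<in>prime_factors n'. p ^ multiplicity p n')" 
    using prod_prime_factors[of n'] n'0 by simp
  also have "\<dots> = \<Prod>(prime_factors n')"
  proof (rule prod.cong[OF refl])
    fix p assume "p \<in> prime_factors n'"
    then have p: "prime p" "p dvd n'" by auto
    have "\<not> p ^ 2 dvd n" using rough[OF p] good p by (auto simp: almost_squarefree_def split: if_splits)
    then have "\<not> p ^ 2 dvd n'" by (auto simp: nn')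
    then have "multiplicity p n' < 2" by (simp add: pow_dvd p n'0)
    moreover have "multiplicity p n' \<noteq> 0" using p n'0 by (simp add: prime_multiplicity_gt_zero_iff)
    ultimately have "multiplicity p n' = 1" by simp
    then show "p ^ multiplicity p n' = p" by simp
  qed
  also have "prime_factors n' = {p. prime p \<and> P < p \<and> p dvd n}"
  proof (intro equalityI subsetI)
    fix p assume "p \<in> prime_factors n'"
    then have p: "prime p" "p dvd n'" by auto
    then show "p \<in> {p. prime p \<and> P < p \<and> p dvd n}" using rough[OF p] by (simp add: nn')
  next
    fix p assume "p \<in> {p. prime p \<and> P < p \<and> p dvd n}"
    then have p: "prime p" "P < p" "p dvd d \<or> p dvd n'" by (auto simp: nn' prime_dvd_mult_iff)
    then have "p dvd n'" using small[of p] by auto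
    then show "p \<in> prime_factors n'" using p n'0 by (simp add: prime_factors_dvd)
  qed
  finally show "n div d = \<Prod>{p. prime p \<and> P < p \<and> p dvd n}" by (simp add: n'_def)
qed

lemma sum_inverse_squares_le:
  assumes "P > 0"
  shows "(\<Sum>p=P+1..N. 1 / real p ^ 2) \<le> 1 / P"
proof (cases "N \<ge> P")
  case True
  then have "(\<Sum>p=P+1..N. 1 / real p ^ 2) \<le> 1 / P - 1 / N"
  proof (induction N rule: dec_induct)
    case (step m)
    have "1 / real (Suc m) ^ 2 \<le> 1 / m - 1 / Suc m"
    proof -
      have "1 / real (Suc m) ^ 2 \<le> 1 / (real m * Suc m)"
        using step assms unfolding power2_eq_square by (intro divide_left_mono mult_right_mono mult_pos_pos) auto
      also have "\<dots> = 1 / m - 1 / Suc m" using step assms by (simp add: field_simps)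
      finally show ?thesis .
    qed
    then show ?case using step by simp
  qed auto
  also have "\<dots> \<le> 1 / P" by simp
  finally show ?thesis .
qed auto

text \<open>Union bound over all integers p \<ge> 2: at most P classes of density at most 2^-P, and
  a tail of 1/p^2 beyond P. The density tends to 0 as P grows, uniformly in N.\<close>

lemma card_not_almost_squarefree:
  fixes P N :: nat
  assumes P: "P > 0"
  shows "card {n\<in>{1..N}. \<not> almost_squarefree P n} \<le> N * (P / 2 ^ P + 1 / P)"
proof -
  define M where "M m = {n\<in>{1..N}. m dvd n}" for m
  have M: "finite (M m)" "real (card (M m)) \<le> N / m" if "m > 0" for m :: nat
    using card_multiples[of N m] real_div_bounds(2)[OF that, of N] by (auto simp: M_def)
  have sub: "{n\<in>{1..N}. \<not> almost_squarefree P n} \<subseteq> (\<Union>p\<in>{2..P}. M (p ^ P)) \<union> (\<Union>p\<in>{P+1..N}. M (p ^ 2))"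
  proof
    fix n assume "n \<in> {n\<in>{1..N}. \<not> almost_squarefree P n}"
    then obtain p where n: "1 \<le> n" "n \<le> N" and p: "prime p" "p ^ (if p \<le> P then P else 2) dvd n"
      by (auto simp: almost_squarefree_def)
    show "n \<in> (\<Union>p\<in>{2..P}. M (p ^ P)) \<union> (\<Union>p\<in>{P+1..N}. M (p ^ 2))"
    proof (cases "p \<le> P")
      case True
      then show ?thesis using p n prime_ge_2_nat[of p] by (auto simp: M_def)
    next
      case False
      then have "p ^ 2 \<le> n" using p n by (auto intro: dvd_imp_le)
      then have "p \<le> N" using n power2_nat_le_imp_le[of p n] by simp
      then show ?thesis using p n False by (auto simp: M_def)
    qed
  qed
  have "card {n\<in>{1..N}. \<not> almost_squarefree P n} \<le> card ((\<Union>p\<in>{2..P}. M (p ^ P)) \<union> (\<Union>p\<in>{P+1..N}. M (p ^ 2)))"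
    by (intro card_mono sub) (auto simp: M_def)
  also have "\<dots> \<le> (\<Sum>p\<in>{2..P}. card (M (p ^ P))) + (\<Sum>p\<in>{P+1..N}. card (M (p ^ 2)))"
    by (intro order.trans[OF card_Un_le] add_mono card_UN_le) auto
  finally have "real (card {n\<in>{1..N}. \<not> almost_squarefree P n}) \<le> 
      (\<Sum>p\<in>{2..P}. real (card (M (p ^ P)))) + (\<Sum>p\<in>{P+1..N}. real (card (M (p ^ 2))))"
    unfolding of_nat_sum[symmetric] of_nat_add[symmetric] of_nat_le_iff .
  also have "\<dots> \<le> (\<Sum>p\<in>{2..P}. N / 2 ^ P) + (\<Sum>p\<in>{P+1..N}. N * (1 / real p ^ 2))"
  proof (intro add_mono sum_mono)
    fix p assume p: "p \<in> {2..P}"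
    then have "real (card (M (p ^ P))) \<le> N / (real p ^ P)" using M(2)[of "p ^ P"] by simp
    also have "\<dots> \<le> N / 2 ^ P" using p by (intro divide_left_mono power_mono mult_pos_pos) auto
    finally show "real (card (M (p ^ P))) \<le> N / 2 ^ P" .
  next
    fix p assume "p \<in> {P+1..N}"
    then show "real (card (M (p ^ 2))) \<le> N * (1 / real p ^ 2)" using M(2)[of "p ^ 2"] by simp
  qed
  also have "\<dots> \<le> P * (N / 2 ^ P) + N * (1 / P)"
    unfolding sum_distrib_left[symmetric] using sum_inverse_squares_le[OF P, of N]
    by (intro add_mono mult_left_mono) (auto intro!: mult_right_mono divide_right_mono)
  finally show ?thesis by (simp add: algebra_simps)
qed

text \<open>One threshold must serve all finite sets beyond it, as the primes in
  \<open>{P<..N}\<close> will vary with N. Unconditional summability supplies a finite set carrying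
  all but \<eta> of the total, and nonnegativity bounds everything disjoint from it.\<close>

lemma summable_on_primes_tail:
  fixes g :: "nat \<Rightarrow> real"
  assumes sum: "g summable_on A" and nonneg: "\<And>x. x \<in> A \<Longrightarrow> g x \<ge> 0" and "\<eta> > 0"
  obtains P0 where "\<And>S. finite S \<Longrightarrow> S \<subseteq> A \<Longrightarrow> (\<And>p. p \<in> S \<Longrightarrow> p > P0) \<Longrightarrow> sum g S \<le> \<eta>"
proof -
  define I where "I = infsum g A"
  have "(g has_sum I) A" using sum by (simp add: I_def)
  then have "\<forall>\<^sub>F F in finite_subsets_at_top A. dist (sum g F) I < \<eta>"
    unfolding has_sum_def using \<open>\<eta> > 0\<close> by (rule tendstoD)
  then obtain F where F: "finite F" "F \<subseteq> A" "dist (sum g F) I < \<eta>"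
    unfolding eventually_finite_subsets_at_top by blast
  show thesis
  proof (rule that[of "Max (insert 0 F)"])
    fix S assume S: "finite S" "S \<subseteq> A" "\<And>p. p \<in> S \<Longrightarrow> p > Max (insert 0 F)"
    have "S \<inter> F = {}" using S(3) F(1) by (meson Max_ge disjoint_iff finite.insertI insertI2 not_le)
    then have "sum g (F \<union> S) = sum g F + sum g S" using F S by (intro sum.union_disjoint) auto
    moreover have "sum g (F \<union> S) \<le> I" unfolding I_def using F S nonneg sum
      by (intro finite_sum_le_infsum) auto
    ultimately show "sum g S \<le> \<eta>" using F(3) by (simp add: dist_real_def)
  qed
qed

text \<open>The order of quantifiers is the point: t does not depend on \<epsilon>, q and G do not
  depend on N, c does. For almost squarefree n, multiplicativity makes f(n) equal to n^(it) G(n)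
  times the product of h(p) over the primes p > P dividing n, and concentration replaces this
  product by c.\<close>

lemma pretentious_approximation:
  assumes f: "f \<in> mult_unit_disc" and pret: "pretentious f"
  obtains t where "\<And>\<epsilon>::real. \<epsilon> > 0 \<Longrightarrow> \<exists>q G. q > 0 \<and> (\<forall>n. G (n + q) = G n) \<and> (\<forall>n. norm (G n) \<le> 1) \<and>
    (\<forall>N. \<exists>c. norm c \<le> 1 \<and> norm c \<ge> 1/2 \<and> (\<Sum>n=1..N. norm (f n - c * nit t n * G n)) \<le> \<epsilon> * N)"
proof -
  obtain q \<psi> and t :: real where chi: "dirichlet_character q \<psi>" and
    summ: "(\<lambda>p. 1 / real p * (1 - Re (f p * cnj (\<psi> p * of_nat p powr (\<i> * of_real t)))))
          summable_on {p. prime p}"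
    using pret unfolding pretentious_def by blast
  have q: "q > 0" and per: "\<And>n. \<psi> (n + q) = \<psi> n"
    using chi unfolding dirichlet_character_def by auto
  have f_mult: "\<And>m n. m > 0 \<Longrightarrow> n > 0 \<Longrightarrow> coprime m n \<Longrightarrow> f (m * n) = f m * f n"
    and f_le: "\<And>n. n > 0 \<Longrightarrow> norm (f n) \<le> 1"
    using f unfolding mult_unit_disc_def by auto
  define h where "h p = f p * cnj (\<psi> p * nit t p)" for p
  have h_le: "norm (h p) \<le> 1" if "prime p" for p
    unfolding h_def using f_le[of p] dirichlet_character_norm(2)[OF chi, of p] that
    by (auto simp: norm_mult prime_gt_0_nat intro!: mult_le_one)
  define g where "g p = (1 - Re (h p)) / p" for p
  have g_nonneg: "g p \<ge> 0" if "prime p" for p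
    using h_le[OF that] complex_Re_le_cmod[of "h p"] by (simp add: g_def)
  have g_sum: "g summable_on {p. prime p}"
  proof -
    have "1 / real p * (1 - Re (f p * cnj (\<psi> p * of_nat p powr (\<i> * of_real t)))) = g p"
      if "p \<in> {p. prime p}" for p
    proof -
      have "p > 0" using that by (simp add: prime_gt_0_nat)
      then show ?thesis by (simp only: powr_eq_nit g_def h_def) simp
    qed
    then show ?thesis using summ by (subst (asm) summable_on_cong) auto
  qed
  show thesis
  proof (rule that[of t])
    fix \<epsilon> :: real assume eps: "\<epsilon> > 0"
    show "\<exists>q G. q > 0 \<and> (\<forall>n. G (n + q) = G n) \<and> (\<forall>n. norm (G n) \<le> 1) \<and>
      (\<forall>N. \<exists>c. norm c \<le> 1 \<and> norm c \<ge> 1/2 \<and> (\<Sum>n=1..N. norm (f n - c * nit t n * G n)) \<le> \<epsilon> * N)"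
    proof (cases "f 1 = 1")
      \<comment> \<open>Multiplicativity leaves only f(1) = 0 here, and then f vanishes on the
        positive integers.\<close>
      case False
      have "f 1 = f 1 * f 1" using f_mult[of 1 1] by simp
      then have "f 1 = 0" using False by simp
      then have f0: "f n = 0" if "n > 0" for n using f_mult[of 1 n] that by simp
      show ?thesis
        by (intro exI[of _ 1] exI[of _ "\<lambda>_. 0"] conjI allI exI[of _ 1]) (use f0 eps in auto)
    next
      case True
      \<comment> \<open>With \<eta> = \<delta>^2 the concentration error is at most 9 \<delta> + 4
        \<delta> = 13 \<delta>, below \<epsilon>/2 because \<delta> \<le> \<epsilon>/50; and
        \<delta> \<le> 1/2 gives 1 - \<eta> \<ge> 1/2.\<close>
      define \<delta> where "\<delta> = min (1/2) (\<epsilon> / 50)"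
      define \<eta> where "\<eta> = \<delta>\<^sup>2"
      have delta: "\<delta> > 0" "\<delta> \<le> 1/2" "\<delta> \<le> \<epsilon>/50" using eps by (auto simp: \<delta>_def)
      have eta: "\<eta> > 0" using delta by (simp add: \<eta>_def)
      have eta_le: "\<eta> \<le> \<delta> / 2" using delta mult_left_mono[of \<delta> "1/2" \<delta>] by (simp add: \<eta>_def power2_eq_square)
      have "sqrt (12 * \<eta>) \<le> sqrt (16 * \<eta>)" using eta by simp
      also have "\<dots> = 4 * \<delta>" using delta by (simp add: \<eta>_def real_sqrt_mult)
      finally have conc: "18 * \<eta> + sqrt (12 * \<eta>) \<le> \<epsilon> / 2" using eta_le delta by linarith
      obtain P0 where P0: "\<And>S. finite S \<Longrightarrow> S \<subseteq> {p. prime p} \<Longrightarrow> (\<And>p. p \<in> S \<Longrightarrow> p > P0) \<Longrightarrow> sum g S \<le> \<eta>"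
        using summable_on_primes_tail[OF g_sum _ eta] g_nonneg by auto
      \<comment> \<open>P has three tasks: the exceptional n, each costing at most 2, contribute at
        most \<epsilon>/2 on average; P > P0 makes the prime tail small; P > q keeps the primes
        beyond P coprime to q.\<close>
      have "((\<lambda>P::nat. 2 * (P / 2 ^ P + 1 / P)) \<longlongrightarrow> 0) at_top" by real_asymp
      then have "eventually (\<lambda>P::nat. 2 * (P / 2 ^ P + 1 / P) < \<epsilon> / 2) at_top"
        using eps by (intro order_tendstoD(2)) auto
      moreover have "eventually (\<lambda>P::nat. P > P0 + q) at_top" by (rule eventually_gt_at_top)
      ultimately have "eventually (\<lambda>P::nat. 2 * (P / 2 ^ P + 1 / P) < \<epsilon> / 2 \<and> P > P0 + q) at_top"
        by eventually_elim auto
      then obtain P :: nat where P: "2 * (P / 2 ^ P + 1 / P) < \<epsilon> / 2" "P > P0 + q"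
        by (auto simp: eventually_at_top_linorder)
      define D :: nat where "D = fact P ^ P"
      \<comment> \<open>The class of n modulo q D determines d = gcd n D and the class of n div d
        modulo q. The conjugate of d^(it) is inserted because n^(it) contains the factor d^(it),
        while pretending brings only (n div d)^(it) into f(n).\<close>
      define G where "G n = (let d = gcd n D in f d * cnj (nit t d) * \<psi> (n div d))" for n
      have D0: "D > 0" by (simp add: D_def)
      have G_per: "G (n + q * D) = G n" for n
      proof -
        define d where "d = gcd n D"
        have d: "d > 0" "d dvd D" using D0 by (auto simp: d_def)
        have "gcd (n + q * D) D = d" unfolding d_def by (metis add.commute gcd.commute gcd_add_mult)
        moreover have "(n + q * D) div d = n div d + (D div d) * q"
        proof -
          have "n + q * D = n + ((D div d) * q) * d" using d by simp
          then have "(n + q * D) div d = (n + ((D div d) * q) * d) div d" by (rule arg_cong)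
          also have "\<dots> = (D div d) * q + n div d" using d by (intro div_mult_self1) simp
          finally show ?thesis by simp
        qed
        ultimately show ?thesis using periodic_add_mult[of \<psi>, OF per] by (simp add: G_def d_def Let_def)
      qed
      have G_le: "norm (G n) \<le> 1" for n
      proof -
        have "gcd n D > 0" using D0 by simp
        then show ?thesis unfolding G_def Let_def norm_mult
          using f_le[of "gcd n D"] dirichlet_character_norm(2)[OF chi] by (simp add: mult_le_one)
      qed
      have main: "\<exists>c. norm c \<le> 1 \<and> norm c \<ge> 1/2 \<and> (\<Sum>n=1..N. norm (f n - c * nit t n * G n)) \<le> \<epsilon> * N" for N
      proof -
        define S where "S = {p\<in>{P<..N}. prime p}"
        have S: "finite S" "\<And>p. p \<in> S \<Longrightarrow> prime p" by (auto simp: S_def)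
        have "sum g S \<le> \<eta>" by (rule P0) (use P(2) in \<open>auto simp: S_def\<close>)
        then have small_S: "(\<Sum>p\<in>S. (1 - Re (h p)) / p) \<le> \<eta>" by (simp add: g_def)
        have h_S: "\<And>p. p \<in> S \<Longrightarrow> norm (h p) \<le> 1" using h_le[OF S(2)] .
        obtain c where c: "norm c \<le> 1" "norm c \<ge> 1 - \<eta>"
          "(\<Sum>n=1..N. norm ((\<Prod>p\<in>{p\<in>S. p dvd n}. h p) - c)) \<le> N * (18 * \<eta> + sqrt (12 * \<eta>))"
          by (rule multiplicative_concentration[OF S(1) S(2) h_S small_S])
        have "f n = nit t n * G n * (\<Prod>p\<in>{p\<in>S. p dvd n}. h p)"
          if n: "n \<in> {1..N}" and good: "almost_squarefree P n" for n
        proof -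
          define d where "d = gcd n D"
          define T where "T = {p. prime p \<and> P < p \<and> p dvd n}"
          have n0: "n > 0" using n by simp
          have T: "T = {p\<in>S. p dvd n}" using n by (auto simp: T_def S_def dest: dvd_imp_le)
          have Tfin: "finite T" and Tp: "\<And>p. p \<in> T \<Longrightarrow> prime p \<and> P < p" using S T by (auto simp: T_def)
          have cop: "coprime d (n div d)" and nd: "n div d = \<Prod>T"
            using rough_part[OF n0 good] by (simp_all add: d_def D_def T_def)
          have d0: "d > 0" using n0 by (simp add: d_def)
          have n_eq: "n = d * \<Prod>T" unfolding nd[symmetric] by (simp add: d_def)
          have T0: "\<Prod>T > 0" using Tp by (intro prod_pos) (auto simp: prime_gt_0_nat)
          have fp: "f p = nit t p * \<psi> p * h p" if p: "p \<in> T" for p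
          proof -
            have "coprime p q" using Tp[OF p] P q by (intro prime_imp_coprime) (auto dest: dvd_imp_le)
            then have "norm (\<psi> p) = 1" by (rule dirichlet_character_norm(1)[OF chi])
            then have "(\<psi> p * nit t p) * cnj (\<psi> p * nit t p) = 1"
              unfolding complex_norm_square[symmetric] norm_mult by simp
            then show ?thesis unfolding h_def by (simp only: mult_ac) (simp add: algebra_simps)
          qed
          have "f n = f d * f (\<Prod>T)" using f_mult[of d "\<Prod>T"] d0 T0 cop nd n_eq by simp
          also have "f (\<Prod>T) = (\<Prod>p\<in>T. f p)"
            using True Tfin Tp by (intro multiplicative_prod_primes[OF f_mult]) auto
          also have "\<dots> = (\<Prod>p\<in>T. nit t p) * (\<Prod>p\<in>T. \<psi> p) * (\<Prod>p\<in>T. h p)"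
            unfolding prod.distrib[symmetric] using fp by (intro prod.cong refl) auto
          also have "(\<Prod>p\<in>T. nit t p) = nit t (\<Prod>T)"
            using Tfin Tp by (intro nit_prod[symmetric]) (auto simp: prime_gt_0_nat)
          also have "(\<Prod>p\<in>T. \<psi> p) = \<psi> (\<Prod>T)" by (rule dirichlet_character_prod[OF chi, symmetric])
          finally have 1: "f n = f d * (nit t (\<Prod>T) * \<psi> (\<Prod>T) * (\<Prod>p\<in>T. h p))" .
          have 2: "nit t n = nit t d * nit t (\<Prod>T)" using n_eq nit_mult[OF d0 T0] by simp
          have "nit t d * cnj (nit t d) = 1" unfolding complex_norm_square[symmetric] by simp
          then show ?thesis unfolding 1 2 G_def Let_def d_def[symmetric] nd T[symmetric]
            by (simp add: algebra_simps)
        qed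
        note good = this
        have "(\<Sum>n=1..N. norm (f n - c * nit t n * G n)) \<le> 
            (\<Sum>n=1..N. norm ((\<Prod>p\<in>{p\<in>S. p dvd n}. h p) - c) + 2 * of_bool (\<not> almost_squarefree P n))"
        proof (rule sum_mono)
          fix n assume n: "n \<in> {1..N}"
          show "norm (f n - c * nit t n * G n) \<le> norm ((\<Prod>p\<in>{p\<in>S. p dvd n}. h p) - c) + 2 * of_bool (\<not> almost_squarefree P n)"
          proof (cases "almost_squarefree P n")
            case True
            have "f n - c * nit t n * G n = nit t n * G n * ((\<Prod>p\<in>{p\<in>S. p dvd n}. h p) - c)"
              unfolding good[OF n True] by (simp add: algebra_simps)
            then have "norm (f n - c * nit t n * G n) = norm (G n) * norm ((\<Prod>p\<in>{p\<in>S. p dvd n}. h p) - c)"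
              by (simp add: norm_mult)
            also have "\<dots> \<le> 1 * norm ((\<Prod>p\<in>{p\<in>S. p dvd n}. h p) - c)"
              by (intro mult_right_mono G_le) auto
            finally show ?thesis using True by simp
          next
            case False
            have "norm (f n - c * nit t n * G n) \<le> norm (f n) + norm (c * nit t n * G n)" by (rule norm_triangle_ineq4)
            also have "norm (f n) \<le> 1" using n by (intro f_le) simp
            also have "norm (c * nit t n * G n) \<le> 1" unfolding norm_mult using c G_le
              by (auto intro!: mult_le_one)
            finally show ?thesis using False by (simp add: add_increasing)
          qed
        qed
        also have "\<dots> = (\<Sum>n=1..N. norm ((\<Prod>p\<in>{p\<in>S. p dvd n}. h p) - c)) + 2 * real (card {n\<in>{1..N}. \<not> almost_squarefree P n})"
        proof -
          have "(\<Sum>n=1..N. of_bool (\<not> almost_squarefree P n)) = real (card {n\<in>{1..N}. \<not> almost_squarefree P n})"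
            using sum_filter_of_bool[of "{1..N}" "\<lambda>_. 1::real" "\<lambda>n. \<not> almost_squarefree P n"] by simp
          then show ?thesis by (simp only: sum.distrib sum_distrib_left[symmetric])
        qed
        also have "\<dots> \<le> N * (18 * \<eta> + sqrt (12 * \<eta>)) + 2 * (N * (P / 2 ^ P + 1 / P))"
          using P by (intro add_mono c mult_left_mono card_not_almost_squarefree) auto
        also have "\<dots> = N * (18 * \<eta> + sqrt (12 * \<eta>)) + N * (2 * (P / 2 ^ P + 1 / P))" by simp
        also have "\<dots> \<le> N * (\<epsilon> / 2) + N * (\<epsilon> / 2)"
          using conc P by (intro add_mono mult_left_mono) auto
        also have "\<dots> = \<epsilon> * N" by simp
        finally have "(\<Sum>n=1..N. norm (f n - c * nit t n * G n)) \<le> \<epsilon> * N" .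
        moreover have "norm c \<ge> 1/2" using c eta_le delta by linarith
        ultimately show ?thesis using c by blast
      qed
      show ?thesis using q D0 G_per G_le main by (intro exI[of _ "q * D"] exI[of _ G]) auto
    qed
  qed
qed


subsection \<open>Short averages and correlations\<close>

definition period_mean :: "nat \<Rightarrow> (nat \<Rightarrow> complex) \<Rightarrow> complex" where
  "period_mean q G = (\<Sum>i<q. G i) / of_nat q"

lemma sum_full_period:
  fixes G :: "nat \<Rightarrow> complex"
  assumes per: "\<And>n. G (n + q) = G n"
  shows "(\<Sum>i<q. G (a + i)) = (\<Sum>i<q. G i)"
proof (induction a)
  case (Suc a)
  have "(\<Sum>i<Suc q. G (a + i)) = G a + (\<Sum>i<q. G (Suc a + i))"
    by (subst sum.lessThan_Suc_shift) simp
  moreover have "(\<Sum>i<Suc q. G (a + i)) = (\<Sum>i<q. G (a + i)) + G a" using per[of a] by simp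
  ultimately show ?case using Suc by simp
qed auto

lemma norm_period_mean_le:
  assumes "q > 0" "\<And>n. norm (G n) \<le> 1"
  shows "norm (period_mean q G) \<le> 1"
proof -
  have "norm (\<Sum>i<q. G i) \<le> q * 1" using sum_norm_bound[of "{..<q}" G 1] assms by simp
  then show ?thesis using assms by (simp add: period_mean_def norm_divide)
qed

text \<open>Complete periods contribute exactly their mean; the r < q leftover terms and the
  corresponding part of the mean cost at most r each. The bound is uniform in n and H.\<close>

lemma periodic_short_sum:
  fixes G :: "nat \<Rightarrow> complex"
  assumes q: "q > 0" and per: "\<And>n. G (n + q) = G n" and le: "\<And>n. norm (G n) \<le> 1"
  shows "norm ((\<Sum>h=1..H. G (n + h)) - H * period_mean q G) \<le> 2 * q"
proof -
  define F where "F i = G (Suc n + i)" for i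
  define k r where "k = H div q" and "r = H mod q"
  have H: "H = k * q + r" by (simp add: k_def r_def)
  have r: "r < q" using q by (simp add: r_def)
  have F_per: "F (i + m * q) = F i" for i m
    using periodic_add_mult[of G q "Suc n + i" m, OF per] by (simp add: F_def add.assoc)
  have full: "(\<Sum>i<k * q. F i) = k * (q * period_mean q G)"
  proof -
    have "(\<Sum>i<k * q. F i) = (\<Sum>m<k. \<Sum>i\<in>{m * q..<m * q + q}. F i)" by (rule sum.nat_group[symmetric])
    also have "\<dots> = (\<Sum>m<k. \<Sum>i<q. F (i + m * q))"
      by (simp add: sum.atLeastLessThan_shift_0[of F] atLeast0LessThan add.commute)
    also have "\<dots> = (\<Sum>m<k. q * period_mean q G)"
      unfolding F_per using q sum_full_period[of G q "Suc n", OF per] by (simp add: F_def period_mean_def)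
    finally show ?thesis by simp
  qed
  have "(\<Sum>h=1..H. G (n + h)) = (\<Sum>i<H. F i)"
    by (simp add: F_def sum.atLeast1_atMost_eq)
  also have "\<dots> = (\<Sum>i<k * q. F i) + (\<Sum>i=k * q..<H. F i)"
    using sum.atLeastLessThan_concat[of 0 "k * q" H F] H by (simp add: atLeast0LessThan)
  finally have "(\<Sum>h=1..H. G (n + h)) - H * period_mean q G = (\<Sum>i=k * q..<H. F i) - r * period_mean q G"
    unfolding full by (simp add: H algebra_simps)
  also have "norm \<dots> \<le> norm (\<Sum>i=k * q..<H. F i) + norm (r * period_mean q G)" by (rule norm_triangle_ineq4)
  also have "norm (\<Sum>i=k * q..<H. F i) \<le> r"
    using sum_norm_bound[of "{k * q..<H}" F 1] le by (simp add: F_def H)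
  also have "norm (r * period_mean q G) \<le> r"
    using norm_period_mean_le[of q G, OF q le] by (simp add: norm_mult mult_left_le)
  finally show ?thesis using r by simp
qed

lemma nit_lipschitz:
  assumes "0 < n" "n \<le> m"
  shows "norm (nit t m - nit t n) \<le> \<bar>t\<bar> * (real (m - n) / n)"
proof -
  have "norm (nit t m - nit t n) \<le> norm (\<i> * of_real (t * ln (real m)) - \<i> * of_real (t * ln (real n)) :: complex)"
    unfolding nit_def by (rule norm_exp_diff_le) auto
  also have "\<dots> = norm (\<i> * complex_of_real (t * (ln (real m) - ln (real n))))" by (simp add: algebra_simps)
  also have "\<dots> = \<bar>t\<bar> * \<bar>ln (real m) - ln (real n)\<bar>" by (simp only: norm_mult norm_ii norm_of_real abs_mult)
  also have "\<bar>ln (real m) - ln (real n)\<bar> = ln (real m / real n)" using assms by (simp add: ln_div)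
  also have "\<dots> \<le> real m / real n - 1" using assms by (intro ln_le_minus_one) auto
  also have "\<dots> = real (m - n) / n" using assms by (simp add: field_simps of_nat_diff)
  finally show ?thesis by (simp add: mult_left_mono)
qed

text \<open>One approximant for one \<epsilon>, with its error on every initial range. The constant
  stays existential inside \<open>approx\<close>: each proof fetches it once, at the right end of
  the largest range it touches, so that all windows in that range share it.\<close>

locale archimedean_periodic_approximation =
  fixes f G :: "nat \<Rightarrow> complex" and t \<epsilon> :: real and q :: nat
  assumes q: "q > 0" and per: "G (n + q) = G n" and G_le: "norm (G n) \<le> 1"
    and approx: "\<exists>c. norm c \<le> 1 \<and> norm c \<ge> 1/2 \<and> (\<Sum>n=1..N. norm (f n - c * nit t n * G n)) \<le> \<epsilon> * real N"
begin

abbreviation "m \<equiv> period_mean q G"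

text \<open>On the window from \<open>K j\<close> to \<open>(K + 1) j\<close> the factor \<open>n\<^bsup>it\<^esup>\<close> is constant up to
  \<open>\<bar>t\<bar> / K\<close>, so that the sum of \<open>f\<close> over it sees the mean of \<open>G\<close>.\<close>

lemma window_estimate:
  fixes K j :: nat
  assumes K: "K > 0" and j: "j > 0"
  shows "j * norm m \<le> 2 * q + 2 * j * (\<bar>t\<bar> / K) + 2 * \<epsilon> * ((K + 1) * j)
    + 2 * norm (\<Sum>n=1..(K+1)*j. f n) + 2 * norm (\<Sum>n=1..K*j. f n)"
proof -
  define N where "N = K * j"
  have N: "N > 0" using assms by (simp add: N_def)
  have N': "(K + 1) * j = N + j" by (simp add: N_def)
  obtain c where c: "norm c \<le> 1" "norm c \<ge> 1/2"
      "(\<Sum>n=1..N+j. norm (f n - c * nit t n * G n)) \<le> \<epsilon> * real (N + j)"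
    using approx by blast
  have split: "(\<Sum>n=1..N+j. F n) = (\<Sum>n=1..N. F n) + (\<Sum>h=1..j. F (N + h))" for F :: "nat \<Rightarrow> 'a::comm_monoid_add"
    using sum.ub_add_nat[of 1 N F j] sum.shift_bounds_cl_nat_ivl[of F 1 N j] by (simp add: add.commute)
  \<comment> \<open>The window inherits the error of the whole range 1..N + j, which is K + 1 times
    as long as the window.\<close>
  have err: "(\<Sum>h=1..j. norm (f (N + h) - c * nit t (N + h) * G (N + h))) \<le> \<epsilon> * real (N + j)"
    using c(3) unfolding split by (rule order.trans[rotated]) (simp add: sum_nonneg)
  have win: "norm (\<Sum>h=1..j. f (N + h)) \<le> norm (\<Sum>n=1..N+j. f n) + norm (\<Sum>n=1..N. f n)"
    using norm_triangle_ineq4[of "\<Sum>n=1..N+j. f n" "\<Sum>n=1..N. f n"] split[of f] by simp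
  define A where "A = (\<Sum>h=1..j. G (N + h))"
  define E1 where "E1 = (\<Sum>h=1..j. c * (nit t (N + h) - nit t N) * G (N + h))"
  define E2 where "E2 = (\<Sum>h=1..j. f (N + h) - c * nit t (N + h) * G (N + h))"
  have eq: "c * nit t N * A = (\<Sum>h=1..j. f (N + h)) - E1 - E2"
    unfolding A_def E1_def E2_def sum_distrib_left sum_subtractf[symmetric]
    by (intro sum.cong refl) (simp add: algebra_simps)
  have "norm E1 \<le> (\<Sum>h=1..j. \<bar>t\<bar> / K)"
    unfolding E1_def
  proof (rule sum_norm_le)
    fix h assume h: "h \<in> {1..j}"
    have "norm (nit t (N + h) - nit t N) \<le> \<bar>t\<bar> * (real h / N)"
      using nit_lipschitz[OF N, of "N + h" t] by simp
    also have "\<dots> \<le> \<bar>t\<bar> * (real j / N)" using h by (intro mult_left_mono divide_right_mono) auto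
    also have "\<dots> = \<bar>t\<bar> / K" using j by (simp add: N_def)
    finally have "norm c * norm (nit t (N + h) - nit t N) * norm (G (N + h)) \<le> 1 * (\<bar>t\<bar> / K) * 1"
      using c(1) G_le[of "N + h"] by (intro mult_mono) auto
    then show "norm (c * (nit t (N + h) - nit t N) * G (N + h)) \<le> \<bar>t\<bar> / K" by (simp add: norm_mult)
  qed
  then have E1: "norm E1 \<le> j * (\<bar>t\<bar> / K)" by simp
  have E2: "norm E2 \<le> \<epsilon> * real (N + j)" unfolding E2_def by (rule order.trans[OF norm_sum err])
  have "j * norm m = norm (j * m)" by (simp add: norm_mult)
  also have "\<dots> \<le> norm A + norm (A - j * m)" by (metis norm_minus_commute norm_triangle_sub)
  finally have "j * norm m \<le> norm A + norm (A - j * m)" .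
  moreover have "norm (A - j * m) \<le> 2 * real q"
    unfolding A_def using periodic_short_sum[of q G, OF q per G_le] by simp
  \<comment> \<open>Dividing by c costs a factor 2, the source of every factor 2 in the claim except
    that of 2 q.\<close>
  moreover have "norm A \<le> 2 * norm (c * nit t N * A)"
    using c(2) mult_right_mono[of "1/2" "norm c" "norm A"] by (simp add: norm_mult)
  moreover have "norm (c * nit t N * A) \<le> norm (\<Sum>h=1..j. f (N + h)) + norm E1 + norm E2"
    unfolding eq by (intro order.trans[OF norm_triangle_ineq4] add_right_mono norm_triangle_ineq4)
  ultimately show ?thesis using win E1 E2
    unfolding N' N_def[symmetric] of_nat_mult of_nat_numeral mult.assoc by linarith
qed

text \<open>Divide the window estimate by j and let j grow with K fixed: both initial sums are o(j)
  as f has mean zero, and 2 q / j vanishes. The two terms left pull K in opposite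
  directions.\<close>

lemma norm_period_mean_bound:
  fixes K :: nat
  assumes mz: "mean_zero f" and K: "K > 0"
  shows "norm m \<le> 2 * (\<bar>t\<bar> / K) + 2 * \<epsilon> * (K + 1)"
proof -
  define a where "a N = norm ((\<Sum>n=1..N. f n) / of_nat N)" for N
  have a: "a \<longlonglongrightarrow> 0" using mz unfolding mean_zero_def a_def by (rule tendsto_norm_zero)
  define e where "e j = 2 * q / real j + 2 * (K + 1) * a ((K + 1) * j) + 2 * K * a (K * j)" for j
  have sub: "(\<lambda>j. a (k * j)) \<longlonglongrightarrow> 0" if "k > 0" for k
    using LIMSEQ_subseq_LIMSEQ[OF a, of "\<lambda>j. k * j"] that by (simp add: o_def strict_mono_def)
  have "(\<lambda>j. 2 * q / real j) \<longlonglongrightarrow> 0" by real_asymp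
  then have "e \<longlonglongrightarrow> 0 + real (2 * (K + 1)) * 0 + real (2 * K) * 0"
    unfolding e_def using K by (intro tendsto_intros sub) auto
  then have e0: "e \<longlonglongrightarrow> 0" by simp
  have lim: "(\<lambda>j. (2 * (\<bar>t\<bar> / K) + 2 * \<epsilon> * (K + 1)) + e j) \<longlonglongrightarrow> 2 * (\<bar>t\<bar> / K) + 2 * \<epsilon> * (K + 1)"
    using tendsto_add[OF tendsto_const e0] by simp
  show ?thesis
  proof (rule LIMSEQ_le_const[OF lim])
    show "\<exists>n. \<forall>j\<ge>n. norm m \<le> (2 * (\<bar>t\<bar> / K) + 2 * \<epsilon> * (K + 1)) + e j"
    proof (intro exI[of _ 1] allI impI)
      fix j :: nat assume "j \<ge> 1"
      then have j: "j > 0" by simp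
      have na: "norm (\<Sum>n=1..N. f n) = N * a N" if "N > 0" for N using that by (simp add: a_def norm_divide)
      have "j * norm m \<le> j * (2 * (\<bar>t\<bar> / K) + 2 * \<epsilon> * (K + 1) + e j)"
        using window_estimate[OF K j] K j na[of "(K + 1) * j"] na[of "K * j"] 
        by (simp add: e_def algebra_simps del: mult_Suc)
      then show "norm m \<le> 2 * (\<bar>t\<bar> / K) + 2 * \<epsilon> * (K + 1) + e j" using j by simp
    qed
  qed
qed

text \<open>The three terms have different sources: the approximation error, counted once per shift
  h; the drift of n^(it) over H steps, at most |t| H / n per summand, whose sum over n is harmonic;
  and the sum of G over an interval of length H.\<close>

lemma short_sums:
  "(\<Sum>n=1..N. norm (\<Sum>h=1..H. f (n + h)))
     \<le> H * (\<epsilon> * real (N + H)) + \<bar>t\<bar> * H\<^sup>2 * harm N + N * (H * norm m + 2 * q)"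
proof -
  obtain c where c: "norm c \<le> 1" "norm c \<ge> 1/2"
      "(\<Sum>n=1..N+H. norm (f n - c * nit t n * G n)) \<le> \<epsilon> * real (N + H)"
    using approx by blast
  define r where "r n = norm (f n - c * nit t n * G n)" for n
  have bound: "norm (\<Sum>h=1..H. f (n + h)) \<le> (\<Sum>h=1..H. r (n + h)) + \<bar>t\<bar> * H\<^sup>2 * inverse n + (H * norm m + 2 * q)"
    if n: "n > 0" for n
  proof -
    have eq: "(\<Sum>h=1..H. f (n + h)) = (\<Sum>h=1..H. f (n + h) - c * nit t (n + h) * G (n + h))
       + (\<Sum>h=1..H. c * (nit t (n + h) - nit t n) * G (n + h)) + c * nit t n * (\<Sum>h=1..H. G (n + h))"
      unfolding sum_distrib_left sum.distrib[symmetric] by (intro sum.cong refl) (simp add: algebra_simps)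
    have "norm (\<Sum>h=1..H. f (n + h) - c * nit t (n + h) * G (n + h)) \<le> (\<Sum>h=1..H. r (n + h))"
      unfolding r_def by (rule norm_sum)
    moreover have "norm (\<Sum>h=1..H. c * (nit t (n + h) - nit t n) * G (n + h)) \<le> \<bar>t\<bar> * H\<^sup>2 * inverse n"
    proof -
      have "norm (\<Sum>h=1..H. c * (nit t (n + h) - nit t n) * G (n + h)) \<le> (\<Sum>h=1..H. \<bar>t\<bar> * (real H / n))"
      proof (rule sum_norm_le)
        fix h assume h: "h \<in> {1..H}"
        have "norm (nit t (n + h) - nit t n) \<le> \<bar>t\<bar> * (real h / n)"
          using nit_lipschitz[OF n, of "n + h" t] by simp
        also have "\<dots> \<le> \<bar>t\<bar> * (real H / n)" using h by (intro mult_left_mono divide_right_mono) auto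
        finally have "norm c * norm (nit t (n + h) - nit t n) * norm (G (n + h)) \<le> 1 * (\<bar>t\<bar> * (real H / n)) * 1"
          using c(1) G_le[of "n + h"] by (intro mult_mono) auto
        then show "norm (c * (nit t (n + h) - nit t n) * G (n + h)) \<le> \<bar>t\<bar> * (real H / n)" by (simp add: norm_mult)
      qed
      then show ?thesis by (simp add: power2_eq_square field_simps)
    qed
    moreover have "norm (c * nit t n * (\<Sum>h=1..H. G (n + h))) \<le> H * norm m + 2 * q"
    proof -
      have "norm (c * nit t n * (\<Sum>h=1..H. G (n + h))) = norm c * norm (\<Sum>h=1..H. G (n + h))"
        by (simp add: norm_mult)
      also have "\<dots> \<le> 1 * norm (\<Sum>h=1..H. G (n + h))" using c by (intro mult_right_mono) auto
      also have "norm (\<Sum>h=1..H. G (n + h)) \<le> norm (H * m) + norm ((\<Sum>h=1..H. G (n + h)) - H * m)"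
        by (rule norm_triangle_sub)
      also have "norm ((\<Sum>h=1..H. G (n + h)) - H * m) \<le> 2 * q" using periodic_short_sum[of q G, OF q per G_le] by simp
      finally show ?thesis by (simp add: norm_mult)
    qed
    ultimately show ?thesis unfolding eq by - (intro order.trans[OF norm_triangle_ineq] add_mono; assumption)
  qed
  have "(\<Sum>n=1..N. norm (\<Sum>h=1..H. f (n + h)))
      \<le> (\<Sum>n=1..N. (\<Sum>h=1..H. r (n + h)) + \<bar>t\<bar> * H\<^sup>2 * inverse n + (H * norm m + 2 * q))"
    by (intro sum_mono bound) auto
  also have "\<dots> = (\<Sum>h=1..H. \<Sum>n=1..N. r (n + h)) + \<bar>t\<bar> * H\<^sup>2 * harm N + N * (H * norm m + 2 * q)"
    unfolding sum.distrib sum_distrib_left[symmetric] harm_def by (subst sum.swap) (simp add: algebra_simps)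
  also have "(\<Sum>h=1..H. \<Sum>n=1..N. r (n + h)) \<le> (\<Sum>h=1..H. \<epsilon> * real (N + H))"
  proof (rule sum_mono)
    fix h assume h: "h \<in> {1..H}"
    have "(\<Sum>n=1..N. r (n + h)) = (\<Sum>n=1+h..N+h. r n)" by (rule sum.shift_bounds_cl_nat_ivl[symmetric])
    also have "\<dots> \<le> (\<Sum>n=1..N+H. r n)" using h by (intro sum_mono2) (auto simp: r_def)
    also have "\<dots> \<le> \<epsilon> * real (N + H)" using c(3) by (simp add: r_def)
    finally show "(\<Sum>n=1..N. r (n + h)) \<le> \<epsilon> * real (N + H)" .
  qed
  finally show ?thesis by simp
qed

text \<open>Exchanging the sums over h and n turns the averaged correlation into the mean of f(n)
  times the conjugate of the sum of f over the H places after n; |f| \<le> 1 leaves the mean of the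
  norms of short sums. For fixed H the drift term is O(log N / N) and disappears in the
  limit.\<close>

lemma correlation_average_bound:
  fixes N :: "nat \<Rightarrow> nat" and C :: "nat \<Rightarrow> complex"
  assumes f_le: "\<And>n. n > 0 \<Longrightarrow> norm (f n) \<le> 1" and N: "filterlim N at_top sequentially"
    and C: "\<And>h. (\<lambda>k. (\<Sum>n=1..N k. f n * cnj (f (n + h))) / of_nat (N k)) \<longlonglongrightarrow> C h"
    and H: "H > 0"
  shows "norm ((\<Sum>h=1..H. C h) / of_nat H) \<le> \<epsilon> + norm m + 2 * q / H"
proof -
  define B where "B n = \<epsilon> * (1 + H / real n) + \<bar>t\<bar> * H * ((ln (real n) + 1) / n) + (norm m + 2 * q / H)" for n :: nat
  have "(\<lambda>n. \<epsilon> * (1 + H / real n)) \<longlonglongrightarrow> \<epsilon> * (1 + 0)"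
    by (intro tendsto_intros)
  moreover have "(\<lambda>n. \<bar>t\<bar> * H * ((ln (real n) + 1) / n)) \<longlonglongrightarrow> \<bar>t\<bar> * H * 0"
    by (intro tendsto_intros) real_asymp
  ultimately have "B \<longlonglongrightarrow> \<epsilon> * (1 + 0) + \<bar>t\<bar> * H * 0 + (norm m + 2 * q / H)"
    unfolding B_def by (intro tendsto_add[OF tendsto_add] tendsto_const)
  then have lim_B: "(\<lambda>k. B (N k)) \<longlonglongrightarrow> \<epsilon> + norm m + 2 * q / H"
    using filterlim_compose[OF _ N] by (simp add: add.assoc)
  define D where "D k = (\<Sum>h=1..H. (\<Sum>n=1..N k. f n * cnj (f (n + h))) / of_nat (N k)) / of_nat H" for k
  have "D \<longlonglongrightarrow> (\<Sum>h=1..H. C h) / of_nat H"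
    unfolding D_def using H by (intro tendsto_intros C) auto
  then have lim_D: "(\<lambda>k. norm (D k)) \<longlonglongrightarrow> norm ((\<Sum>h=1..H. C h) / of_nat H)" by (rule tendsto_norm)
  have "eventually (\<lambda>k. N k \<ge> 1) sequentially" using N by (simp add: filterlim_at_top)
  then have "eventually (\<lambda>k. norm (D k) \<le> B (N k)) sequentially"
  proof eventually_elim
    case (elim k)
    then have Nk: "N k > 0" by simp
    \<comment> \<open>The difference of \<open>harm n\<close> and ln n decreases, and equals 1 at n
      = 1.\<close>
    have harm_le_ln: "harm (N k) \<le> ln (N k) + (1 :: real)"
      using euler_mascheroni_sequence_decreasing[of 1 "N k"] Nk by (simp add: harm_expand)
    have "D k = (\<Sum>n=1..N k. f n * cnj (\<Sum>h=1..H. f (n + h))) / of_nat (H * N k)"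
      unfolding D_def sum_divide_distrib[symmetric] cnj_sum sum_distrib_left
      by (subst sum.swap) (simp add: mult.commute)
    then have "norm (D k) = norm (\<Sum>n=1..N k. f n * cnj (\<Sum>h=1..H. f (n + h))) / (H * N k)"
      by (simp only: norm_divide norm_of_nat)
    also have "\<dots> \<le> (\<Sum>n=1..N k. norm (\<Sum>h=1..H. f (n + h))) / (H * N k)"
    proof (rule divide_right_mono[OF sum_norm_le])
      fix n assume "n \<in> {1..N k}"
      then have "norm (f n) * norm (\<Sum>h=1..H. f (n + h)) \<le> 1 * norm (\<Sum>h=1..H. f (n + h))"
        using f_le[of n] by (intro mult_right_mono) auto
      then show "norm (f n * cnj (\<Sum>h=1..H. f (n + h))) \<le> norm (\<Sum>h=1..H. f (n + h))"
        by (simp only: norm_mult complex_mod_cnj mult_1)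
    qed simp
    also have "\<dots> \<le> (H * (\<epsilon> * real (N k + H)) + \<bar>t\<bar> * (real H)\<^sup>2 * (ln (N k) + 1) + N k * (H * norm m + 2 * q)) / (H * N k)"
    proof (rule divide_right_mono)
      have "\<bar>t\<bar> * (real H)\<^sup>2 * harm (N k) \<le> \<bar>t\<bar> * (real H)\<^sup>2 * (ln (N k) + 1)"
        by (intro mult_left_mono harm_le_ln) simp
      then show "(\<Sum>n=1..N k. norm (\<Sum>h=1..H. f (n + h)))
          \<le> H * (\<epsilon> * real (N k + H)) + \<bar>t\<bar> * (real H)\<^sup>2 * (ln (N k) + 1) + N k * (H * norm m + 2 * q)"
        using short_sums[where N = "N k" and H = H] by linarith
    qed simp
    also have "\<dots> = B (N k)"
      using Nk H unfolding B_def by (simp add: field_simps power2_eq_square)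
    finally show ?case .
  qed
  then show ?thesis by (intro tendsto_le[OF _ lim_B lim_D]) auto
qed

end

lemma mean_zero_imp_correlation_average:
  fixes N :: "nat \<Rightarrow> nat" and C :: "nat \<Rightarrow> complex"
  assumes f: "f \<in> mult_unit_disc" and pret: "pretentious f" and mz: "mean_zero f"
    and N: "filterlim N at_top sequentially"
    and C: "\<And>h. (\<lambda>k. (\<Sum>n=1..N k. f n * cnj (f (n + h))) / of_nat (N k)) \<longlonglongrightarrow> C h"
  shows "(\<lambda>H. (\<Sum>h=1..H. C h) / of_nat H) \<longlonglongrightarrow> 0"
proof (rule tendstoI)
  fix \<eta> :: real assume eta: "\<eta> > 0"
  obtain t where t: "\<And>\<epsilon>::real. \<epsilon> > 0 \<Longrightarrow> \<exists>q G. q > 0 \<and> (\<forall>n. G (n + q) = G n) \<and> (\<forall>n. norm (G n) \<le> 1) \<and>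
    (\<forall>N. \<exists>c. norm c \<le> 1 \<and> norm c \<ge> 1/2 \<and> (\<Sum>n=1..N. norm (f n - c * nit t n * G n)) \<le> \<epsilon> * N)"
    using pretentious_approximation[OF f pret] by blast
  have f_le: "\<And>n. n > 0 \<Longrightarrow> norm (f n) \<le> 1" using f by (auto simp: mult_unit_disc_def)
  have "(\<lambda>K. 2 * (\<bar>t\<bar> / real K)) \<longlonglongrightarrow> 0" by real_asymp
  then have "eventually (\<lambda>K. 2 * (\<bar>t\<bar> / real K) < \<eta> / 4 \<and> K > 0) sequentially"
    using eta by (intro eventually_conj order_tendstoD(2) eventually_gt_at_top) auto
  then obtain K :: nat where K: "2 * (\<bar>t\<bar> / real K) < \<eta> / 4" "K > 0"
    by (auto simp: eventually_at_top_linorder)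
  \<comment> \<open>Three quarters of \<eta> are spent: 2 |t| / K stays below one quarter,
    \<epsilon> x = \<epsilon> + 2 \<epsilon> (K + 1) equals one, and 2 q / H is below one once H is
    large. As q comes with \<epsilon>, H is chosen last.\<close>
  define x where "x = 2 * real K + 3"
  define \<epsilon> where "\<epsilon> = \<eta> / (4 * x)"
  have x: "x > 0" by (simp add: x_def)
  then have eps: "\<epsilon> > 0" using eta by (simp add: \<epsilon>_def)
  have "\<epsilon> + 2 * \<epsilon> * (real K + 1) = \<epsilon> * x" by (simp add: x_def algebra_simps)
  also have "\<dots> = \<eta> / 4" using x by (simp add: \<epsilon>_def)
  finally have eps': "\<epsilon> + 2 * \<epsilon> * (real K + 1) = \<eta> / 4" .
  obtain q G where "archimedean_periodic_approximation f G t \<epsilon> q"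
    using t[OF eps] unfolding archimedean_periodic_approximation_def by blast
  then interpret archimedean_periodic_approximation f G t \<epsilon> q .
  have m: "norm m \<le> 2 * (\<bar>t\<bar> / K) + 2 * \<epsilon> * (real K + 1)"
    using norm_period_mean_bound[OF mz K(2)] by (simp add: add.commute)
  have "(\<lambda>H. 2 * q / real H) \<longlonglongrightarrow> 0" by real_asymp
  then have "eventually (\<lambda>H. 2 * q / real H < \<eta> / 4) sequentially"
    using eta by (intro order_tendstoD(2)) auto
  with eventually_gt_at_top[of 0]
  show "eventually (\<lambda>H. dist ((\<Sum>h=1..H. C h) / of_nat H) 0 < \<eta>) sequentially"
  proof eventually_elim
    case (elim H)
    show ?case using correlation_average_bound[OF f_le N C elim(1)] elim m K eps' eta by simp
  qed
qed


subsection \<open>Existence of Furstenberg systems\<close>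

text \<open>A variant of the function in Schoenberg's space-filling curve: 2-periodic, equal to 0 on
  [0, 1/3] and to 1 on [2/3, 1], here obtained by clipping a cosine instead of piecewise linearly.
  It reads off a leading ternary digit 0 or 2 continuously.\<close>

definition schoenberg_wave :: "real \<Rightarrow> real" where
  "schoenberg_wave x = max 0 (min 1 (1/2 - cos (pi * x)))"

lemma schoenberg_wave_bounds: "0 \<le> schoenberg_wave x" "schoenberg_wave x \<le> 1"
  by (auto simp: schoenberg_wave_def)

lemma continuous_schoenberg_wave: "continuous_on A schoenberg_wave"
  unfolding schoenberg_wave_def by (intro continuous_intros)

lemma schoenberg_wave_periodic: "schoenberg_wave (x + 2 * real m) = schoenberg_wave x"
proof -
  have "cos (pi * (x + 2 * real m)) = cos (pi * x + 2 * pi * of_nat m)" by (simp add: algebra_simps)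
  also have "\<dots> = cos (pi * x)" by (induction m) (auto simp: algebra_simps cos_add sin_add)
  finally show ?thesis by (simp add: schoenberg_wave_def)
qed

lemma schoenberg_wave_left:
  assumes "0 \<le> x" "x \<le> 1/3"
  shows "schoenberg_wave x = 0"
proof -
  have "pi * x \<le> pi * (1/3)" using assms by (intro mult_left_mono) auto
  then have "cos (pi / 3) \<le> cos (pi * x)" using assms by (intro cos_monotone_0_pi_le) auto
  then show ?thesis by (simp add: schoenberg_wave_def cos_60)
qed

lemma schoenberg_wave_right:
  assumes "2/3 \<le> x" "x \<le> 1"
  shows "schoenberg_wave x = 1"
proof -
  have "pi * (2/3) \<le> pi * x" "pi * x \<le> pi * 1" using assms by (intro mult_left_mono; simp)+
  then have "cos (pi * x) \<le> cos (2 * pi / 3)" using assms by (intro cos_monotone_0_pi_le) auto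
  then show ?thesis by (simp add: schoenberg_wave_def cos_120)
qed

text \<open>The point of Cantor's set whose digits 0 and 2 are prescribed by b. As the digit 1 is
  absent, the gap between 1/3 and 2/3 leaves the wave room to pass from 0 to 1.\<close>

definition ternary :: "(nat \<Rightarrow> bool) \<Rightarrow> real" where
  "ternary b = (\<Sum>i. 2 * of_bool (b i) / 3 ^ Suc i)"

lemma summable_ternary: "summable (\<lambda>i. 2 * of_bool (b i) / 3 ^ Suc i :: real)"
proof (rule summable_comparison_test')
  show "summable (\<lambda>i. (1/3) ^ i :: real)" by (intro summable_geometric) auto
  show "norm (2 * of_bool (b i) / 3 ^ Suc i :: real) \<le> (1/3) ^ i" for i
    by (auto simp: field_simps of_bool_def)
qed

lemma ternary_rec: "ternary b = 2 * of_bool (b 0) / 3 + ternary (\<lambda>i. b (Suc i)) / 3"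
proof -
  have "ternary b = 2 * of_bool (b 0) / 3 + (\<Sum>i. 2 * of_bool (b (Suc i)) / 3 ^ Suc i / 3)"
    unfolding ternary_def using suminf_split_head[OF summable_ternary[of b]] by (simp add: mult_ac)
  then show ?thesis unfolding ternary_def by (simp only: suminf_divide[OF summable_ternary])
qed

lemma ternary_bounds: "0 \<le> ternary b" "ternary b \<le> 1"
proof -
  show "0 \<le> ternary b" unfolding ternary_def by (intro suminf_nonneg summable_ternary) auto
  have "ternary b \<le> (\<Sum>i. 2/3 * (1/3) ^ i)" unfolding ternary_def
    by (intro suminf_le summable_ternary summable_mult summable_geometric) (auto simp: field_simps of_bool_def)
  also have "\<dots> = 1" by (subst suminf_mult) (auto intro!: summable_geometric simp: suminf_geometric)
  finally show "ternary b \<le> 1" .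
qed

text \<open>Multiplying by 3^k moves digit k to the front. The digits passed over add an even
  integer, because they are 0 or 2, and the period 2 removes it.\<close>

lemma schoenberg_wave_ternary: "schoenberg_wave (3 ^ k * ternary b) = of_bool (b k)"
proof (induction k arbitrary: b)
  case 0
  show ?case
    using ternary_bounds[of "\<lambda>i. b (Suc i)"] ternary_rec[of b]
    by (cases "b 0") (auto intro!: schoenberg_wave_left schoenberg_wave_right)
next
  case (Suc k)
  have "3 ^ Suc k * ternary b = 3 ^ k * ternary (\<lambda>i. b (Suc i)) + 2 * real (of_bool (b 0) * 3 ^ k)"
    by (subst ternary_rec) (auto simp: algebra_simps)
  then show ?case by (simp only: schoenberg_wave_periodic Suc)
qed

lemma binary_expansion:
  fixes y :: real
  assumes "0 \<le> y" "y < 1"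
  shows "\<exists>b. (\<lambda>i. of_bool (b i) / 2 ^ Suc i) sums y"
proof -
  define b where "b i = odd \<lfloor>2 ^ Suc i * y\<rfloor>" for i :: nat
  have partial: "(\<Sum>i<n. of_bool (b i) / 2 ^ Suc i) = \<lfloor>2 ^ n * y\<rfloor> / 2 ^ n" for n
  proof (induction n)
    case 0
    have "\<lfloor>y\<rfloor> = 0" using assms by (intro floor_unique) auto
    then show ?case by simp
  next
    case (Suc n)
    have "\<lfloor>2 ^ Suc n * y\<rfloor> div 2 = \<lfloor>2 ^ n * y\<rfloor>"
      using floor_divide_real_eq_div[of 2 "2 ^ Suc n * y"] by simp
    then have "\<lfloor>2 ^ Suc n * y\<rfloor> = 2 * \<lfloor>2 ^ n * y\<rfloor> + of_bool (b n)"
      unfolding b_def by (metis (no_types) mult_div_mod_eq of_bool_odd_eq_mod_2)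
    then have "real_of_int \<lfloor>2 ^ Suc n * y\<rfloor> = 2 * real_of_int \<lfloor>2 ^ n * y\<rfloor> + of_bool (b n)" by simp
    then show ?case using Suc by (simp add: field_simps)
  qed
  have "(\<lambda>n. \<lfloor>2 ^ n * y\<rfloor> / 2 ^ n) \<longlonglongrightarrow> y"
  proof (rule tendsto_sandwich)
    show "(\<lambda>n. y - 1 / 2 ^ n) \<longlonglongrightarrow> y" by real_asymp
    show "(\<lambda>n::nat. y) \<longlonglongrightarrow> y" by simp
    show "\<forall>\<^sub>F n in sequentially. y - 1 / 2 ^ n \<le> \<lfloor>2 ^ n * y\<rfloor> / 2 ^ n"
    proof (intro always_eventually allI)
      fix n :: nat
      have "2 ^ n * y - 1 \<le> \<lfloor>2 ^ n * y\<rfloor>" by linarith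
      then have "(2 ^ n * y - 1) / 2 ^ n \<le> \<lfloor>2 ^ n * y\<rfloor> / 2 ^ n" by (intro divide_right_mono) auto
      then show "y - 1 / 2 ^ n \<le> \<lfloor>2 ^ n * y\<rfloor> / 2 ^ n" by (simp add: diff_divide_distrib)
    qed
    show "\<forall>\<^sub>F n in sequentially. \<lfloor>2 ^ n * y\<rfloor> / 2 ^ n \<le> y"
      by (intro always_eventually allI) (simp add: divide_le_eq mult.commute)
  qed
  then show ?thesis unfolding sums_def partial[symmetric] by blast
qed

text \<open>The digits of one Cantor point are dealt out to countably many real numbers: position
  \<open>to_nat (j, r, i)\<close> holds binary digit i of the real part (r false) or imaginary part
  (r true) at j, up to an affine rescaling.\<close>

definition schoenberg_coord :: "int \<Rightarrow> bool \<Rightarrow> real \<Rightarrow> real" where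
  "schoenberg_coord j r t = (\<Sum>i. schoenberg_wave (3 ^ to_nat (j, r, i) * t) / 2 ^ Suc i)"

lemma continuous_schoenberg_coord: "continuous_on A (schoenberg_coord j r)"
proof -
  have bound: "norm (schoenberg_wave (3 ^ to_nat (j, r, i) * t) / 2 ^ Suc i) \<le> (1/2) ^ i" for i t
    using schoenberg_wave_bounds[of "3 ^ to_nat (j, r, i) * t"] by (simp add: field_simps)
  have "uniform_limit A (\<lambda>n t. \<Sum>i<n. schoenberg_wave (3 ^ to_nat (j, r, i) * t) / 2 ^ Suc i)
      (\<lambda>t. \<Sum>i. schoenberg_wave (3 ^ to_nat (j, r, i) * t) / 2 ^ Suc i) sequentially"
    by (rule Weierstrass_m_test[OF bound]) (auto intro: summable_geometric)
  then show ?thesis unfolding schoenberg_coord_def[abs_def]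
    by (rule uniform_limit_theorem[rotated])
      (auto intro!: always_eventually continuous_intros continuous_on_compose2[OF continuous_schoenberg_wave[of UNIV]])
qed

text \<open>A surjection of the Cantor set onto the sequence space which extends continuously to the
  line lets Helly's selection theorem for measures on the line do the work of weak-star
  compactness.\<close>

lemma disc_seqs_continuous_image:
  obtains g :: "real \<Rightarrow> int \<Rightarrow> complex"
  where "continuous_on UNIV g" and "\<And>t. g t \<in> disc_seqs" and "\<And>x. x \<in> disc_seqs \<Longrightarrow> \<exists>t\<in>{0..1}. g t = x"
proof
  \<comment> \<open>The range [0, 1] of the coordinates is stretched to [-2, 2] and projected to the
    disc, so every t gives an admissible sequence. Conversely, coordinates in [-1, 1] come from y in
    [1/4, 3/4], clear of the value 1 that \<open>binary_expansion\<close> excludes.\<close>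
  define g where "g t = (\<lambda>j. closest_point (cball 0 1)
      (Complex (4 * schoenberg_coord j False t - 2) (4 * schoenberg_coord j True t - 2)))" for t
  show "continuous_on UNIV g"
    unfolding g_def Complex_eq
    by (intro continuous_on_coordinatewise_then_product continuous_on_compose2[OF continuous_on_closest_point]
        continuous_intros continuous_schoenberg_coord) auto
  show "g t \<in> disc_seqs" for t
    using closest_point_in_set[of "cball 0 1 :: complex set"] by (auto simp: disc_seqs_def g_def)
  fix x assume x: "x \<in> disc_seqs"
  define y where "y j r = ((if r then Im (x j) else Re (x j)) + 2) / 4" for j r
  have "0 \<le> y j r \<and> y j r < 1" for j r
    using x abs_Re_le_cmod[of "x j"] abs_Im_le_cmod[of "x j"] 
    by (auto simp: y_def disc_seqs_def dest!: spec[of _ j])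
  then have "\<exists>b. (\<lambda>i. of_bool (b i) / 2 ^ Suc i) sums y j r" for j r using binary_expansion by blast
  then obtain b where b: "\<And>j r. (\<lambda>i. of_bool (b j r i) / 2 ^ Suc i) sums y j r" by metis
  define t where "t = ternary (\<lambda>k. case from_nat k of (j :: int, r :: bool, i :: nat) \<Rightarrow> b j r i)"
  have coord: "schoenberg_coord j r t = y j r" for j r
    unfolding schoenberg_coord_def t_def schoenberg_wave_ternary using b[of j r] by (simp add: sums_iff)
  have "g t = x"
  proof
    fix j
    have "Complex (4 * schoenberg_coord j False t - 2) (4 * schoenberg_coord j True t - 2) = x j"
      unfolding coord by (simp add: y_def complex_eq_iff field_simps)
    then show "g t j = x j" using x by (simp add: g_def disc_seqs_def closest_point_self)
  qed
  then show "\<exists>t\<in>{0..1}. g t = x" using ternary_bounds by (auto simp: t_def)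
qed

section \<open>Empirical measures and their limits\<close>

lemma shift_funpow: "(shift ^^ n) x = (\<lambda>m. x (m + int n))"
  by (induction n) (auto simp: shift_def algebra_simps)

lemma extend_by_zero_in_disc_seqs:
  assumes "f \<in> mult_unit_disc"
  shows "(shift ^^ n) (extend_by_zero f) \<in> disc_seqs"
  using assms by (auto simp: shift_funpow extend_by_zero_def disc_seqs_def mult_unit_disc_def)

lemma measurable_uniform_count_measure_disc_seqs:
  assumes "\<And>n. x n \<in> disc_seqs"
  shows "x \<in> measurable (uniform_count_measure A) disc_seqs_borel"
  using assms by (intro measurableI) (auto simp: space_restrict_space)

lemma integral_empirical_measure:
  fixes \<phi> :: "(int \<Rightarrow> complex) \<Rightarrow> complex"
  assumes f: "f \<in> mult_unit_disc" and \<phi>: "continuous_on disc_seqs \<phi>"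
  shows "(\<integral>x. \<phi> x \<partial>empirical_measure f N) = (\<Sum>n=1..N. \<phi> ((shift ^^ n) (extend_by_zero f))) / of_nat N"
proof -
  have "(\<integral>x. \<phi> x \<partial>empirical_measure f N) = (\<integral>n. \<phi> ((shift ^^ n) (extend_by_zero f)) \<partial>uniform_count_measure {1..N})"
    unfolding empirical_measure_def using borel_measurable_continuous_on_restrict[OF \<phi>]
    by (intro integral_distr measurable_uniform_count_measure_disc_seqs extend_by_zero_in_disc_seqs f)
  also have "\<dots> = (\<Sum>n=1..N. (1 / N) *\<^sub>R \<phi> ((shift ^^ n) (extend_by_zero f)))"
    by (simp add: uniform_count_measure_def lebesgue_integral_point_measure_finite)
  finally show ?thesis by (simp add: scaleR_conv_of_real sum_divide_distrib)
qed

text \<open>The averages are integrals of the continuous function sending x to x(0) times the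
  conjugate of x(h), so weak-star convergence makes them converge. Hence the \<open>lim\<close> in
  \<open>correlation\<close> is a genuine limit.\<close>

lemma correlation_converges:
  assumes f: "f \<in> mult_unit_disc" and N: "defines_furstenberg_system f N"
  shows "(\<lambda>k. (\<Sum>n=1..N k. f n * cnj (f (n + h))) / of_nat (N k)) \<longlonglongrightarrow> correlation f N h"
proof -
  obtain \<mu> where conv: "weak_star_conv (\<lambda>k. empirical_measure f (N k)) \<mu>"
    using N unfolding defines_furstenberg_system_def by blast
  define \<phi> :: "(int \<Rightarrow> complex) \<Rightarrow> complex" where "\<phi> x = x 0 * cnj (x (int h))" for x
  have cont: "continuous_on disc_seqs \<phi>"
    unfolding \<phi>_def
    by (intro continuous_intros continuous_on_subset[OF continuous_on_product_coordinates]) auto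
  have "(\<integral>x. \<phi> x \<partial>empirical_measure f (N k)) = (\<Sum>n=1..N k. f n * cnj (f (n + h))) / of_nat (N k)" for k
  proof -
    have "\<phi> ((shift ^^ n) (extend_by_zero f)) = f n * cnj (f (n + h))" if "n \<in> {1..N k}" for n
      using that by (simp add: \<phi>_def shift_funpow extend_by_zero_def nat_add_distrib add.commute)
    then show ?thesis unfolding integral_empirical_measure[OF f cont] by simp
  qed
  moreover have "(\<lambda>k. \<integral>x. \<phi> x \<partial>empirical_measure f (N k)) \<longlonglongrightarrow> (\<integral>x. \<phi> x \<partial>\<mu>)"
    using conv cont unfolding weak_star_conv_def by blast
  ultimately have "convergent (\<lambda>k. (\<Sum>n=1..N k. f n * cnj (f (n + h))) / of_nat (N k))"
    unfolding convergent_def by (simp only:) blast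
  then show ?thesis unfolding correlation_def by (simp add: convergent_LIMSEQ_iff)
qed

text \<open>Each point of the orbit is lifted to a parameter c n in [0, 1]; any choice of lifts is
  measurable, the index sets being finite and discrete. A weak limit of the empirical measures of
  the parameters, pushed forward by the curve, is a weak-star limit of the original ones.\<close>

lemma furstenberg_subsequence:
  fixes r :: "nat \<Rightarrow> nat"
  assumes f: "f \<in> mult_unit_disc" and r: "strict_mono r" "r 0 > 0"
  obtains s where "strict_mono s" "defines_furstenberg_system f (r \<circ> s)"
proof -
  obtain g :: "real \<Rightarrow> int \<Rightarrow> complex" where g: "continuous_on UNIV g" "\<And>t. g t \<in> disc_seqs"
    and surj: "\<And>x. x \<in> disc_seqs \<Longrightarrow> \<exists>t\<in>{0..1}. g t = x"
    using disc_seqs_continuous_image by metis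
  \<comment> \<open>Clamping makes the composition of a test function with g' bounded on the whole
    line, as weak convergence of real distributions requires.\<close>
  define g' where "g' t = g (max 0 (min 1 t))" for t
  have g'_cont: "continuous_on UNIV g'" unfolding g'_def
    by (intro continuous_on_compose2[OF g(1)] continuous_intros) auto
  have g'_in: "g' t \<in> disc_seqs" for t by (simp add: g'_def g)
  have "\<exists>t\<in>{0..1}. g t = (shift ^^ n) (extend_by_zero f)" for n
    by (intro surj extend_by_zero_in_disc_seqs f)
  then obtain c where c: "\<And>n. c n \<in> {0..1}" "\<And>n. g (c n) = (shift ^^ n) (extend_by_zero f)" by metis
  have g'c: "g' (c n) = (shift ^^ n) (extend_by_zero f)" for n using c[of n] by (simp add: g'_def)
  define \<nu> where "\<nu> k = distr (uniform_count_measure {1..r k}) borel c" for k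
  have rk: "r k > 0" for k using strict_mono_less_eq[OF r(1), of 0 k] r(2) by simp
  have prob: "prob_space (uniform_count_measure {1..r k})" for k
    using rk[of k] by (intro prob_space_uniform_count_measure) auto
  have c_meas: "c \<in> measurable (uniform_count_measure {1..r k}) borel" for k
    by (intro measurableI) auto
  have dist: "real_distribution (\<nu> k)" for k
    unfolding \<nu>_def by (intro prob_space.real_distribution_distr prob c_meas)
  have "tight \<nu>" unfolding tight_def
  proof (intro conjI allI impI dist exI)
    show "(-1 :: real) < 1" by simp
    fix \<epsilon> :: real and k assume "\<epsilon> > 0"
    interpret prob_space "uniform_count_measure {1..r k}" by (rule prob)
    have "measure (\<nu> k) {-1<..1} = prob (c -` {-1<..1} \<inter> space (uniform_count_measure {1..r k}))"
      unfolding \<nu>_def by (rule measure_distr[OF c_meas]) simp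
    also have "c -` {-1<..1} \<inter> space (uniform_count_measure {1..r k}) = space (uniform_count_measure {1..r k})"
      using c(1) by (force simp: greaterThanAtMost_iff)
    also have "prob \<dots> = 1" by (rule prob_space)
    finally have "measure (\<nu> k) {-1<..1} = 1" .
    then show "measure (\<nu> k) {-1<..1} > 1 - \<epsilon>" using \<open>\<epsilon> > 0\<close> by simp
  qed
  then obtain s M where s: "strict_mono s" and M: "real_distribution M" and "weak_conv_m (\<nu> \<circ> id \<circ> s) M"
    using tight_imp_convergent_subsubsequence[of \<nu> id] strict_mono_id by blast
  then have conv: "weak_conv_m (\<nu> \<circ> s) M" by simp
  interpret M: real_distribution M by (rule M)
  have g'_meas: "g' \<in> measurable M disc_seqs_borel"
    using borel_measurable_continuous_onI[OF g'_cont] g'_in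
    by (intro measurable_restrict_space2) (auto simp: measurable_cong_sets[OF M.events_eq_borel refl])
  define \<mu> where "\<mu> = distr M disc_seqs_borel g'"
  have "weak_star_conv (\<lambda>k. empirical_measure f ((r \<circ> s) k)) \<mu>"
    unfolding weak_star_conv_def
  proof (intro allI impI)
    fix \<phi> :: "(int \<Rightarrow> complex) \<Rightarrow> complex" assume \<phi>: "continuous_on disc_seqs \<phi>"
    have cont: "continuous_on UNIV (\<lambda>t. \<phi> (g' t))"
      using g'_in by (intro continuous_on_compose2[OF \<phi> g'_cont]) auto
    have "compact ((\<lambda>t. \<phi> (g' t)) ` {0..1})"
      by (intro compact_continuous_image continuous_on_subset[OF cont]) auto
    then obtain B where B: "\<And>t. t \<in> {0..1} \<Longrightarrow> norm (\<phi> (g' t)) \<le> B"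
      using compact_imp_bounded bounded_iff by (metis imageI)
    have "norm (\<phi> (g' t)) \<le> B" for t
      using B[of "max 0 (min 1 t)"] by (simp add: g'_def)
    moreover have "isCont (\<lambda>t. \<phi> (g' t)) t" for t using cont by (simp add: continuous_on_eq_continuous_at)
    ultimately have "(\<lambda>k. \<integral>t. \<phi> (g' t) \<partial>(\<nu> \<circ> s) k) \<longlonglongrightarrow> (\<integral>t. \<phi> (g' t) \<partial>M)"
      using dist by (intro weak_conv_imp_integral_bdd_continuous_conv[OF _ M conv]) auto
    moreover have "(\<integral>t. \<phi> (g' t) \<partial>(\<nu> \<circ> s) k) = (\<integral>x. \<phi> x \<partial>empirical_measure f ((r \<circ> s) k))" for k
    proof -
      have "(\<integral>t. \<phi> (g' t) \<partial>(\<nu> \<circ> s) k) = (\<integral>n. \<phi> (g' (c n)) \<partial>uniform_count_measure {1..r (s k)})"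
        unfolding \<nu>_def o_def by (intro integral_distr c_meas borel_measurable_continuous_onI cont)
      also have "\<dots> = (\<integral>x. \<phi> x \<partial>empirical_measure f ((r \<circ> s) k))"
        unfolding empirical_measure_def o_def g'c
        by (intro integral_distr[symmetric] borel_measurable_continuous_on_restrict[OF \<phi>]
          measurable_uniform_count_measure_disc_seqs extend_by_zero_in_disc_seqs f)
      finally show ?thesis .
    qed
    moreover have "(\<integral>t. \<phi> (g' t) \<partial>M) = (\<integral>x. \<phi> x \<partial>\<mu>)"
      unfolding \<mu>_def by (intro integral_distr[symmetric] g'_meas borel_measurable_continuous_on_restrict[OF \<phi>])
    ultimately show "(\<lambda>k. \<integral>x. \<phi> x \<partial>empirical_measure f ((r \<circ> s) k)) \<longlonglongrightarrow> (\<integral>x. \<phi> x \<partial>\<mu>)" by simp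
  qed
  moreover have "prob_space \<mu>" unfolding \<mu>_def by (rule M.prob_space_distr[OF g'_meas])
  moreover have "sets \<mu> = sets disc_seqs_borel" by (simp add: \<mu>_def)
  ultimately have "defines_furstenberg_system f (r \<circ> s)"
    unfolding defines_furstenberg_system_def using r s rk by (auto intro: strict_mono_o)
  with s show thesis by (rule that)
qed


subsection \<open>Van der Corput's inequality\<close>

lemma norm_sum_shift_diff:
  fixes F :: "nat \<Rightarrow> complex"
  assumes le: "\<And>n. n > 0 \<Longrightarrow> norm (F n) \<le> 1"
  shows "norm ((\<Sum>n=1..N. F (n + h)) - (\<Sum>n=1..N. F n)) \<le> 2 * h"
proof (induction h)
  case (Suc h)
  have "(\<Sum>n=1..N. F (n + Suc h)) - (\<Sum>n=1..N. F (n + h)) = F (N + Suc h) - F (Suc h)"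
    using sum_Suc_diff[of 1 N "\<lambda>n. F (n + h)"] by (simp add: sum_subtractf)
  then have "norm ((\<Sum>n=1..N. F (n + Suc h)) - (\<Sum>n=1..N. F (n + h))) \<le> 2"
    using norm_triangle_ineq4[of "F (N + Suc h)" "F (Suc h)"] le[of "N + Suc h"] le[of "Suc h"] by simp
  from norm_diff_triangle_le[OF this Suc] show ?case by simp
qed auto

text \<open>From |S m| \<le> (e/2) m + B, where B absorbs finitely many m, summing over m < H gives
  at most (e/2) H^2 + B H.\<close>

lemma Cesaro_partial_sums:
  fixes S :: "nat \<Rightarrow> 'a::real_normed_field"
  assumes S: "(\<lambda>m. S m / of_nat m) \<longlonglongrightarrow> 0"
  shows "(\<lambda>H. (\<Sum>m<H. norm (S m)) / (real H)\<^sup>2) \<longlonglongrightarrow> 0"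
proof (rule tendstoI)
  fix e :: real assume e: "e > 0"
  have "eventually (\<lambda>m. norm (S m / of_nat m) < e / 2) sequentially"
    using tendstoD[OF S, of "e/2"] e by simp
  then obtain m0 where m0: "\<And>m. m \<ge> m0 \<Longrightarrow> norm (S m / of_nat m) < e / 2"
    by (auto simp: eventually_at_top_linorder)
  define B where "B = (\<Sum>m\<le>m0. norm (S m))"
  have B: "norm (S m) \<le> e / 2 * m + B" for m
  proof (cases "m \<le> m0")
    case True
    then have "norm (S m) \<le> B" unfolding B_def by (intro member_le_sum) auto
    then show ?thesis using e by (simp add: add_increasing)
  next
    case False
    have "B \<ge> 0" unfolding B_def by (intro sum_nonneg) auto
    have "norm (S m) = norm (S m / of_nat m) * m" using False by (simp add: norm_divide)
    also have "\<dots> \<le> e / 2 * m" using m0[of m] False by (intro mult_right_mono) auto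
    finally show ?thesis using \<open>B \<ge> 0\<close> by simp
  qed
  have "(\<lambda>H. B / real H) \<longlonglongrightarrow> 0" by real_asymp
  then have "eventually (\<lambda>H. B / real H < e / 2) sequentially" using e by (intro order_tendstoD(2)) auto
  with eventually_gt_at_top[of 0]
  show "eventually (\<lambda>H. dist ((\<Sum>m<H. norm (S m)) / (real H)\<^sup>2) 0 < e) sequentially"
  proof eventually_elim
    case (elim H)
    have "(\<Sum>m<H. norm (S m)) \<le> (\<Sum>m<H. e / 2 * H + B)"
      using e by (intro sum_mono order.trans[OF B] add_right_mono mult_left_mono) auto
    then have "(\<Sum>m<H. norm (S m)) / (real H)\<^sup>2 \<le> (H * (e / 2 * H + B)) / (real H)\<^sup>2"
      by (intro divide_right_mono) auto
    also have "\<dots> = e / 2 + B / H" using elim by (simp add: field_simps power2_eq_square)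
    finally have "(\<Sum>m<H. norm (S m)) / (real H)\<^sup>2 < e" using elim by linarith
    moreover have "(\<Sum>m<H. norm (S m)) / (real H)\<^sup>2 \<ge> 0" by (intro divide_nonneg_nonneg sum_nonneg) auto
    ultimately show ?case by simp
  qed
qed

text \<open>H times the mean of f is, up to boundary terms of order H^2 / N, the mean of the sums of
  f over H consecutive places. By Cauchy-Schwarz the square of the latter mean is at most the mean
  of squared norms \<open>V H k\<close>, which converges to a double sum of correlations that is
  o(H^2).\<close>

lemma van_der_Corput_mean:
  fixes f :: "nat \<Rightarrow> complex" and N :: "nat \<Rightarrow> nat" and C :: "nat \<Rightarrow> complex"
  assumes f_le: "\<And>n. n > 0 \<Longrightarrow> norm (f n) \<le> 1" and N: "filterlim N at_top sequentially"
    and C: "\<And>h. (\<lambda>k. (\<Sum>n=1..N k. f n * cnj (f (n + h))) / of_nat (N k)) \<longlonglongrightarrow> C h"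
    and Cmean: "(\<lambda>H. (\<Sum>h=1..H. C h) / of_nat H) \<longlonglongrightarrow> 0"
  shows "(\<lambda>k. (\<Sum>n=1..N k. f n) / of_nat (N k)) \<longlonglongrightarrow> 0"
proof -
  define S where "S m = (\<Sum>h=1..m. C h)" for m
  \<comment> \<open>The limiting correlation depends on h' - h alone; a negative difference becomes
    a positive one after conjugation.\<close>
  define C2 where "C2 h h' = (if h \<le> h' then C (h' - h) else cnj (C (h - h')))" for h h'
  define D where "D h h' k = (\<Sum>n=1..N k. f (n + h) * cnj (f (n + h'))) / of_nat (N k)" for h h' k
  define V where "V H k = (\<Sum>n=1..N k. (norm (\<Sum>h<H. f (n + h)))\<^sup>2) / N k" for H k
  define L where "L H = (\<Sum>h'<H. \<Sum>h<H. C2 h h')" for H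
  have N0: "eventually (\<lambda>k. N k > 0) sequentially" by (rule eventually_compose_filterlim[OF eventually_gt_at_top N])
  have inv_N: "(\<lambda>k. a / real (N k)) \<longlonglongrightarrow> 0" for a :: real
    by (rule tendsto_divide_0[OF tendsto_const filterlim_at_top_imp_at_infinity])
      (rule filterlim_compose[OF filterlim_real_sequentially N])
  have D_le: "D h h' \<longlonglongrightarrow> C (h' - h)" if "h \<le> h'" for h h'
  proof -
    define F where "F n = f n * cnj (f (n + (h' - h)))" for n
    have F_le: "norm (F n) \<le> 1" if "n > 0" for n
      using f_le[of n] f_le[of "n + (h' - h)"] that by (simp add: F_def norm_mult mult_le_one)
    have "(\<lambda>k. D h h' k - (\<Sum>n=1..N k. F n) / of_nat (N k)) \<longlonglongrightarrow> 0"
    proof (rule Lim_null_comparison[OF always_eventually inv_N[of "2 * real h"]], rule allI)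
      fix k
      have "D h h' k - (\<Sum>n=1..N k. F n) / of_nat (N k) = ((\<Sum>n=1..N k. F (n + h)) - (\<Sum>n=1..N k. F n)) / of_nat (N k)"
        using that by (simp add: D_def F_def diff_divide_distrib add.assoc)
      then show "norm (D h h' k - (\<Sum>n=1..N k. F n) / of_nat (N k)) \<le> 2 * real h / real (N k)"
        using norm_sum_shift_diff[where F = F and N = "N k" and h = h, OF F_le] by (simp add: norm_divide divide_right_mono)
    qed
    moreover have "(\<lambda>k. (\<Sum>n=1..N k. F n) / of_nat (N k)) \<longlonglongrightarrow> C (h' - h)"
      unfolding F_def by (rule C)
    ultimately have "(\<lambda>k. (D h h' k - (\<Sum>n=1..N k. F n) / of_nat (N k)) + (\<Sum>n=1..N k. F n) / of_nat (N k))
        \<longlonglongrightarrow> 0 + C (h' - h)" by (rule tendsto_add)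
    then show ?thesis by (simp only: diff_add_cancel add_0_left)
  qed
  have D_lim: "D h h' \<longlonglongrightarrow> C2 h h'" for h h'
  proof (cases "h \<le> h'")
    case True
    then show ?thesis using D_le by (simp add: C2_def)
  next
    case False
    have "D h h' = (\<lambda>k. cnj (D h' h k))" by (simp add: D_def fun_eq_iff cnj_sum mult.commute)
    then show ?thesis using tendsto_cnj[OF D_le[of h' h]] False by (simp add: C2_def)
  qed
  have V_lim: "(\<lambda>k. complex_of_real (V H k)) \<longlonglongrightarrow> L H" for H
  proof -
    have "complex_of_real (V H k) = (\<Sum>h'<H. \<Sum>h<H. D h h' k)" for k
    proof -
      have "complex_of_real (V H k) = (\<Sum>n=1..N k. \<Sum>h'<H. \<Sum>h<H. f (n + h) * cnj (f (n + h'))) / of_nat (N k)"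
        unfolding V_def of_real_divide of_real_sum complex_norm_square cnj_sum sum_product
        by (subst sum.swap) simp
      also have "(\<Sum>n=1..N k. \<Sum>h'<H. \<Sum>h<H. f (n + h) * cnj (f (n + h'))) = (\<Sum>h'<H. \<Sum>h<H. \<Sum>n=1..N k. f (n + h) * cnj (f (n + h')))"
        by (subst sum.swap) (intro sum.cong refl sum.swap)
      finally show ?thesis by (simp only: D_def sum_divide_distrib)
    qed
    then show ?thesis unfolding L_def by (simp only:) (intro tendsto_sum D_lim)
  qed
  have L_bound: "norm (L H) \<le> H * norm (C 0) + 2 * (\<Sum>m<H. norm (S m))" for H
  proof -
    \<comment> \<open>For fixed h' the indices h \<le> h' run through C 0, ..., C h' and those above
      h' through the conjugates of C 1, ..., C (H - 1 - h'). So only C 0 and partial sums enter, and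
      partial sums are what \<open>Cmean\<close> controls.\<close>
    have inner: "(\<Sum>h<H. C2 h h') = C 0 + S h' + cnj (S (H - Suc h'))" if h': "h' < H" for h'
    proof -
      have "(\<Sum>h<H. C2 h h') = (\<Sum>h<Suc h'. C2 h h') + (\<Sum>h=Suc h'..<H. C2 h h')"
        using sum.atLeastLessThan_concat[of 0 "Suc h'" H "\<lambda>h. C2 h h'"] h' by (simp add: atLeast0LessThan)
      also have "(\<Sum>h<Suc h'. C2 h h') = (\<Sum>h<Suc h'. C (Suc h' - Suc h))"
        by (intro sum.cong refl) (simp add: C2_def)
      also have "\<dots> = (\<Sum>h<Suc h'. C h)" by (rule sum.nat_diff_reindex)
      also have "\<dots> = C 0 + S h'"
        unfolding S_def sum.lessThan_Suc_shift by (simp add: sum.atLeast1_atMost_eq)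
      also have "(\<Sum>h=Suc h'..<H. C2 h h') = (\<Sum>h=Suc h'..<H. cnj (C (h - h')))"
        by (intro sum.cong refl) (simp add: C2_def)
      also have "\<dots> = cnj (S (H - Suc h'))"
        unfolding S_def cnj_sum by (simp add: sum.atLeastLessThan_shift_0[of _ "Suc h'"] sum.atLeast1_atMost_eq atLeast0LessThan)
      finally show ?thesis .
    qed
    have "norm (L H) \<le> (\<Sum>h'<H. norm (C 0) + norm (S h') + norm (S (H - Suc h')))"
      unfolding L_def
    proof (rule sum_norm_le)
      fix h' assume "h' \<in> {..<H}"
      then have "norm (\<Sum>h<H. C2 h h') = norm (C 0 + S h' + cnj (S (H - Suc h')))" by (simp add: inner)
      also have "\<dots> \<le> norm (C 0) + norm (S h') + norm (cnj (S (H - Suc h')))"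
        by (intro order.trans[OF norm_triangle_ineq] add_right_mono norm_triangle_ineq)
      finally show "norm (\<Sum>h<H. C2 h h') \<le> norm (C 0) + norm (S h') + norm (S (H - Suc h'))" by simp
    qed
    also have "\<dots> = H * norm (C 0) + 2 * (\<Sum>m<H. norm (S m))"
      using sum.nat_diff_reindex[of "\<lambda>m. norm (S m)" H] by (simp add: sum.distrib)
    finally show ?thesis .
  qed
  have L_small: "(\<lambda>H. norm (L H) / (real H)\<^sup>2) \<longlonglongrightarrow> 0"
  proof (rule Lim_null_comparison)
    show "eventually (\<lambda>H. norm (norm (L H) / (real H)\<^sup>2) \<le> norm (C 0) / H + 2 * ((\<Sum>m<H. norm (S m)) / (real H)\<^sup>2)) sequentially"
      using eventually_gt_at_top[of 0]
    proof eventually_elim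
      case (elim H)
      have "norm (L H) / (real H)\<^sup>2 \<le> (H * norm (C 0) + 2 * (\<Sum>m<H. norm (S m))) / (real H)\<^sup>2"
        by (intro divide_right_mono L_bound) auto
      also have "\<dots> = norm (C 0) / H + 2 * ((\<Sum>m<H. norm (S m)) / (real H)\<^sup>2)"
        using elim by (simp add: add_divide_distrib power2_eq_square)
      finally show ?case by simp
    qed
    have "(\<lambda>H. norm (C 0) / real H) \<longlonglongrightarrow> 0" by real_asymp
    moreover have "(\<lambda>H. 2 * ((\<Sum>m<H. norm (S m)) / (real H)\<^sup>2)) \<longlonglongrightarrow> 2 * 0"
      by (intro tendsto_mult tendsto_const Cesaro_partial_sums) (use Cmean in \<open>simp add: S_def\<close>)
    ultimately show "(\<lambda>H. norm (C 0) / H + 2 * ((\<Sum>m<H. norm (S m)) / (real H)\<^sup>2)) \<longlonglongrightarrow> 0"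
      using tendsto_add by fastforce
  qed
  have mean_bound: "norm ((\<Sum>n=1..N k. f n) / of_nat (N k)) \<le> 2 * H / N k + sqrt (V H k / (real H)\<^sup>2)"
    if H: "H > 0" and Nk: "N k > 0" for H k
  proof -
    define A where "A n = (\<Sum>h<H. f (n + h))" for n
    define z where "z = (\<Sum>n=1..N k. f n)"
    have swap: "(\<Sum>n=1..N k. A n) = (\<Sum>h<H. \<Sum>n=1..N k. f (n + h))" unfolding A_def by (rule sum.swap)
    have "norm ((\<Sum>n=1..N k. A n) - H * z) = norm (\<Sum>h<H. (\<Sum>n=1..N k. f (n + h)) - z)"
      unfolding swap by (simp add: sum_subtractf)
    also have "\<dots> \<le> (\<Sum>h<H. 2 * real H)"
    proof (rule sum_norm_le)
      fix h assume "h \<in> {..<H}"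
      then show "norm ((\<Sum>n=1..N k. f (n + h)) - z) \<le> 2 * real H"
        using norm_sum_shift_diff[where F = f and N = "N k" and h = h, OF f_le] by (simp add: z_def)
    qed
    finally have 1: "norm ((\<Sum>n=1..N k. A n) - H * z) \<le> H * (2 * H)" by simp
    have "norm (\<Sum>n=1..N k. A n) \<le> (\<Sum>n=1..N k. norm (A n))" by (rule norm_sum)
    also have "\<dots> \<le> sqrt ((N k)\<^sup>2 * V H k)"
    proof (rule real_le_rsqrt)
      have "(\<Sum>n=1..N k. norm (A n))\<^sup>2 \<le> (\<Sum>n=1..N k. (norm (A n))\<^sup>2) * (\<Sum>n=1..N k. 1\<^sup>2)"
        using Cauchy_Schwarz_ineq_sum[of "\<lambda>n. norm (A n)" "\<lambda>n. 1" "{1..N k}"] by simp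
      also have "\<dots> = (N k)\<^sup>2 * V H k" using Nk by (simp add: V_def A_def power2_eq_square)
      finally show "(\<Sum>n=1..N k. norm (A n))\<^sup>2 \<le> (N k)\<^sup>2 * V H k" .
    qed
    also have "\<dots> = N k * sqrt (V H k)" by (simp add: real_sqrt_mult)
    finally have 2: "norm (\<Sum>n=1..N k. A n) \<le> N k * sqrt (V H k)" .
    have "H * norm z = norm (H * z)" by (simp add: norm_mult)
    also have "\<dots> \<le> norm (\<Sum>n=1..N k. A n) + norm ((\<Sum>n=1..N k. A n) - H * z)"
      by (metis norm_minus_commute norm_triangle_sub)
    also have "\<dots> \<le> N k * sqrt (V H k) + H * (2 * H)" using 1 2 by linarith
    finally have "H * norm z / (H * N k) \<le> (N k * sqrt (V H k) + H * (2 * H)) / (H * N k)"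
      by (intro divide_right_mono) auto
    then have "norm z / N k \<le> sqrt (V H k) / H + 2 * H / N k"
      using H Nk by (simp add: add_divide_distrib)
    then show ?thesis using H by (simp add: z_def norm_divide real_sqrt_divide)
  qed
  show ?thesis
  proof (rule tendstoI)
    fix e :: real assume e: "e > 0"
    \<comment> \<open>H is fixed from the o(H^2) bound before k tends to infinity, so the boundary
      term 2 H / N k still vanishes.\<close>
    have "(\<lambda>H. sqrt (norm (L H) / (real H)\<^sup>2)) \<longlonglongrightarrow> sqrt 0" by (intro tendsto_real_sqrt L_small)
    then have "eventually (\<lambda>H. sqrt (norm (L H) / (real H)\<^sup>2) < e / 2 \<and> H > 0) sequentially"
      using e by (intro eventually_conj order_tendstoD(2) eventually_gt_at_top) auto
    then obtain H :: nat where H: "sqrt (norm (L H) / (real H)\<^sup>2) < e / 2" "H > 0"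
      by (auto simp: eventually_at_top_linorder)
    have V_nonneg: "V H k \<ge> 0" for k unfolding V_def by (intro divide_nonneg_nonneg sum_nonneg) auto
    have lim: "(\<lambda>k. 2 * H / N k + sqrt (V H k / (real H)\<^sup>2)) \<longlonglongrightarrow> 0 + sqrt (norm (L H) / (real H)\<^sup>2)"
    proof (intro tendsto_add inv_N tendsto_real_sqrt tendsto_divide tendsto_const)
      show "V H \<longlonglongrightarrow> norm (L H)" using tendsto_norm[OF V_lim[of H]] V_nonneg by simp
    qed (use H in auto)
    then have "eventually (\<lambda>k. 2 * H / N k + sqrt (V H k / (real H)\<^sup>2) < e) sequentially"
      using H e by (intro order_tendstoD(2)[OF lim]) simp
    with N0 show "eventually (\<lambda>k. dist ((\<Sum>n=1..N k. f n) / of_nat (N k)) 0 < e) sequentially"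
    proof eventually_elim
      case (elim k)
      then show ?case using mean_bound[OF H(2) elim(1)] by simp
    qed
  qed
qed

lemma u1_seminorm_zero_imp_mean_zero:
  assumes f: "f \<in> mult_unit_disc" and u1: "u1_seminorm_zero f"
  shows "mean_zero f"
proof (rule ccontr)
  define z where "z N = (\<Sum>n=1..N. f n) / of_nat N" for N
  have f_le: "\<And>n. n > 0 \<Longrightarrow> norm (f n) \<le> 1" using f by (auto simp: mult_unit_disc_def)
  assume "\<not> mean_zero f"
  then have "\<not> z \<longlonglongrightarrow> 0" by (simp add: mean_zero_def z_def[abs_def])
  then obtain e where e: "e > 0" "\<And>n0. \<exists>n\<ge>n0. norm (z n) \<ge> e"
    by (auto simp: lim_sequentially not_less)
  \<comment> \<open>Positivity is imposed because the lengths defining a Furstenberg system are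
    positive.\<close>
  have "infinite {n. n > 0 \<and> norm (z n) \<ge> e}"
    unfolding infinite_nat_iff_unbounded
  proof
    fix n0
    show "\<exists>n>n0. n \<in> {n. n > 0 \<and> norm (z n) \<ge> e}"
      using e(2)[of "Suc n0"] by (auto simp: Suc_le_eq intro: le_less_trans)
  qed
  then obtain r :: "nat \<Rightarrow> nat" where r: "strict_mono r" "\<And>k. r k > 0" "\<And>k. norm (z (r k)) \<ge> e"
    using infinite_enumerate[of "{n. n > 0 \<and> norm (z n) \<ge> e}"] by blast
  obtain s where s: "strict_mono s" "defines_furstenberg_system f (r \<circ> s)"
    by (rule furstenberg_subsequence[OF f r(1) r(2)])
  have "has_u1_seminorm f (r \<circ> s) 0" using u1 s by (simp add: u1_seminorm_zero_def)
  then have "(\<lambda>H. (\<Sum>h=1..H. correlation f (r \<circ> s) h) / of_nat H) \<longlonglongrightarrow> 0"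
    by (simp add: has_u1_seminorm_def)
  then have "(\<lambda>k. z ((r \<circ> s) k)) \<longlonglongrightarrow> 0"
    unfolding z_def using r s
    by (intro van_der_Corput_mean[OF f_le _ correlation_converges[OF f s(2)]] filterlim_subseq strict_mono_o)
  then have "eventually (\<lambda>k. norm (z ((r \<circ> s) k)) < e) sequentially"
    using e(1) by (simp add: tendsto_iff)
  then show False using r(3) by (auto simp: not_less[symmetric])
qed

theorem proposition3p2:
  fixes f :: "nat \<Rightarrow> complex"
  assumes "f \<in> mult_unit_disc" and "pretentious f"
  shows "u1_seminorm_zero f \<longleftrightarrow> mean_zero f"
proof
  show "mean_zero f" if "u1_seminorm_zero f"
    by (rule u1_seminorm_zero_imp_mean_zero[OF assms(1) that])
  show "u1_seminorm_zero f" if mz: "mean_zero f"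
    unfolding u1_seminorm_zero_def
  proof (intro allI impI)
    fix N assume N: "defines_furstenberg_system f N"
    then have "filterlim N at_top sequentially"
      by (intro filterlim_subseq) (simp add: defines_furstenberg_system_def)
    from mean_zero_imp_correlation_average[OF assms mz this correlation_converges[OF assms(1) N]]
    show "has_u1_seminorm f N 0" by (simp add: has_u1_seminorm_def)
  qed
qed

end
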